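(* Let $s:\Theta\to[0,1]$ be nondecreasing. Then $s$ is feasible (i.e., there exists an allocation $\chi$ inducing it) if and only if $$\int_x^{\bar\theta} s(\theta)\,dF(\theta)\;\le\;\int_x^{\bar\theta} F(\theta)\,dF(\theta)\qquad\text{for all }x\in[0,\bar\theta].$$
   Context: Let $0<\bar\theta<\infty$, $\Theta=[0,\bar\theta]$, and let $F$ be a cumulative distribution function on $\Theta$ with a continuous, strictly positive density $f$; $dF(\theta)=f(\theta)\,d\theta$. A continuum (unit mass) of buyers has types distributed according to $F$. The set of positional-good levels is $X=(0,\infty)$, and $\tilde X=X\cup\{0\}$, where $0$ denotes not buying (exclusion). Let $\Omega=[0,1]$ carry the uniform probability measure. An allocation is a measurable map $\chi:\Theta\times\Omega\to\tilde X$. For each $\omega$, let $G_\chi(q\mid\omega)=\int \mathbf 1[\chi(\theta,\omega)\le q]\,dF(\theta)$ for $q\in\tilde X$, and $G^-_\chi(q\mid\omega)=\lim_{q'\uparrow q}G_\chi(q'\mid\omega)$ (the mass of buyers with strictly lower level, including those with level $0$). The status of a buyer at level $q$ under distribution $G$ is $S(q,G)=\frac{G^-(q)+G(q)}{2}$ if $q\in X$, and $S(0,G)=0$. The interim status induced by $\chi$ is $s(\theta)=\mathbb E_\omega\big[S(\chi(\theta,\omega),G_\chi(\cdot\mid\omega))\big]$. A function $s:\Theta\to[0,1]$ is called feasible if it is the interim status induced by some allocation $\chi$. *)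

theory Defs
  imports "HOL-Analysis.Analysis"
begin

text \<open>Types are \<Theta> = {0..tb}, \<Omega> = {0..1} with Lebesgue (uniform) measure,
  dF(\<theta>) = f \<theta> d\<theta>. Levels: 0 = exclusion, positive reals = positional good levels.\<close>

definition allocation :: "real \<Rightarrow> (real \<Rightarrow> real \<Rightarrow> real) \<Rightarrow> bool" where
  "allocation tb X \<longleftrightarrow>
     (\<lambda>p. X (fst p) (snd p)) \<in> borel_measurable (restrict_space borel ({0..tb} \<times> {0..1::real}))
     \<and> (\<forall>\<theta>\<in>{0..tb}. \<forall>\<omega>\<in>{0..1}. X \<theta> \<omega> \<ge> 0)"

definition levelG :: "real \<Rightarrow> (real \<Rightarrow> real) \<Rightarrow> (real \<Rightarrow> real \<Rightarrow> real) \<Rightarrow> real \<Rightarrow> real \<Rightarrow> real" where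
  "levelG tb f X \<omega> q = (LINT \<theta>:{\<theta>\<in>{0..tb}. X \<theta> \<omega> \<le> q}|lborel. f \<theta>)"

definition levelG_left :: "real \<Rightarrow> (real \<Rightarrow> real) \<Rightarrow> (real \<Rightarrow> real \<Rightarrow> real) \<Rightarrow> real \<Rightarrow> real \<Rightarrow> real" where
  "levelG_left tb f X \<omega> q = Lim (at_left q) (levelG tb f X \<omega>)"

definition status :: "real \<Rightarrow> (real \<Rightarrow> real) \<Rightarrow> (real \<Rightarrow> real \<Rightarrow> real) \<Rightarrow> real \<Rightarrow> real \<Rightarrow> real" where
  "status tb f X \<omega> q =
     (if q = 0 then 0 else (levelG_left tb f X \<omega> q + levelG tb f X \<omega> q) / 2)"

definition interim_status :: "real \<Rightarrow> (real \<Rightarrow> real) \<Rightarrow> (real \<Rightarrow> real \<Rightarrow> real) \<Rightarrow> real \<Rightarrow> real" where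
  "interim_status tb f X \<theta> = (LINT \<omega>:{0..1}|lborel. status tb f X \<omega> (X \<theta> \<omega>))"

definition feasible :: "real \<Rightarrow> (real \<Rightarrow> real) \<Rightarrow> (real \<Rightarrow> real) \<Rightarrow> bool" where
  "feasible tb f s \<longleftrightarrow>
     (\<exists>X. allocation tb X \<and>
        (\<forall>\<theta>\<in>{0..tb}.
           set_integrable lborel {0..1} (\<lambda>\<omega>. status tb f X \<omega> (X \<theta> \<omega>)) \<and>
           s \<theta> = interim_status tb f X \<theta>))"

end

theory Submission
  imports Defs
begin

text \<open>Necessity: a status averages pairwise comparisons, and within \<open>A = [x, tb]\<close>, of mass \<open>p\<close>, these
  cancel to \<open>p\<^sup>2/2\<close>, so the total status of \<open>A\<close> is at most \<open>p\<^sup>2/2 + p(1 - p)\<close>, which is the integral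
  of \<open>F dF\<close> over \<open>A\<close>.

  Sufficiency: consider deterministic allocations that pool intervals of ranks between consecutive
  points of a set \<open>R\<close> and exclude everybody below the least point. When \<open>s\<close> is a step function on a
  grid, a greedy procedure writes it as a mixture of such allocations with \<open>R\<close> decreasing in \<open>\<omega>\<close>.
  The end points \<open>a(\<theta>, \<omega>)\<close> and \<open>b(\<theta>, \<omega>)\<close> of the pool of \<open>\<theta>\<close> are then monotone in \<open>\<omega>\<close>, and being the
  end points of pools is a closed condition, so one can pass to a limit by Tychonoff's theorem as the
  grid is refined. Left limits in \<open>\<theta>\<close> make the result jointly measurable and induce \<open>s\<close> wherever \<open>s\<close>
  is continuous. The countably many remaining types have mass zero and are placed on top of everybody
  with probability \<open>s(\<theta>)\<close> and excluded otherwise.\<close>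

section \<open>Mixtures of pooling partitions on a grid\<close>

text \<open>The limit has to remain a pooling allocation in every single state, since a mixture of
  pooling allocations is in general not one. Hence the pairs of pool end points converge, not just
  the averaged statuses. Their index set of all \<open>(\<theta>, \<omega>)\<close> is uncountable:
  compactness of the product yields a cluster point, but not directly a convergent subsequence, so a
  filter finer than \<open>sequentially\<close> is used. Neither dominated convergence in \<omega>
  nor joint measurability of the limit comes for free along such a filter; both are recovered from
  monotonicity, of the end points in \<omega> and in \<theta> respectively.

  Everything is expressed in ranks \<open>F \<theta>\<close>, which are uniformly distributed, so
  that a pool (a, b] of ranks has the status (a + b) / 2, linear in its end points. The target is
  sampled at the left end of each grid cell. Majorization then passes to the grid as a lower Riemann
  sum, and the limiting status lies between the left limit of \<open>s\<close> and \<open>s\<close>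
  itself, so it can differ from \<open>s\<close> only at discontinuities.\<close>

definition pool_upper :: "nat set \<Rightarrow> nat \<Rightarrow> nat" where
  "pool_upper R i = (LEAST r. r \<in> R \<and> i \<le> r)"

text \<open>The pool below the least point of \<open>R\<close> is excluded; it is encoded as \<open>(-b, b)\<close>, so that its
  midpoint is the status 0 of exclusion.\<close>

definition pool_lower :: "nat set \<Rightarrow> nat \<Rightarrow> real" where
  "pool_lower R i =
     (if \<exists>r\<in>R. r < i then real (Max {r \<in> R. r < i}) else - real (pool_upper R i))"

text \<open>Rank i in {1..n} stands for the cell ((i - 1) / n, i / n] of values of \<open>F\<close>,
  and every point of \<open>R\<close> ends a pool. The sum of the end points is then 2n times the
  common status in the pool; keeping it unscaled avoids fractions.\<close>

definition pool_sum :: "nat set \<Rightarrow> nat \<Rightarrow> real" where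
  "pool_sum R i = pool_lower R i + real (pool_upper R i)"

lemma pool_upper:
  assumes "n \<in> R" "i \<le> n"
  shows "pool_upper R i \<in> R" "i \<le> pool_upper R i" "pool_upper R i \<le> n"
proof -
  have "pool_upper R i \<in> R \<and> i \<le> pool_upper R i"
    unfolding pool_upper_def by (rule LeastI) (use assms in blast)
  then show "pool_upper R i \<in> R" "i \<le> pool_upper R i" by auto
  show "pool_upper R i \<le> n"
    unfolding pool_upper_def by (rule Least_le) (use assms in blast)
qed

lemma pool_upper_le: "r \<in> R \<Longrightarrow> i \<le> r \<Longrightarrow> pool_upper R i \<le> r"
  unfolding pool_upper_def by (rule Least_le) blast

lemma pool_upper_self: "i \<in> R \<Longrightarrow> pool_upper R i = i"
  unfolding pool_upper_def by (rule Least_equality) auto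

lemma pool_lower_ge: "r \<in> R \<Longrightarrow> r < i \<Longrightarrow> real r \<le> pool_lower R i"
  unfolding pool_lower_def by (auto intro!: Max_ge)

lemma pool_lower_cases:
  obtains r where "r \<in> R" "r < i" "pool_lower R i = real r"
  | "\<forall>r\<in>R. i \<le> r" "pool_lower R i = - real (pool_upper R i)"
proof (cases "\<exists>r\<in>R. r < i")
  case True
  then have "Max {r \<in> R. r < i} \<in> {r \<in> R. r < i}"
    by (intro Max_in) auto
  with True that(1) show thesis by (auto simp: pool_lower_def)
next
  case False
  then show thesis by (intro that(2)) (auto simp: pool_lower_def)
qed

lemma pool_lower_le: "pool_lower R i \<le> real i"
  by (rule pool_lower_cases[of R i]) auto

lemma pool_eq:
  assumes "n \<in> R" "i \<le> j" "j \<le> n" "\<forall>r\<in>R. \<not> (i \<le> r \<and> r < j)"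
  shows "pool_upper R j = pool_upper R i" "pool_lower R j = pool_lower R i"
proof -
  have "(r \<in> R \<and> j \<le> r) \<longleftrightarrow> (r \<in> R \<and> i \<le> r)" for r
    using assms by force
  then show 1: "pool_upper R j = pool_upper R i" unfolding pool_upper_def by simp
  have "{r \<in> R. r < j} = {r \<in> R. r < i}" using assms by force
  moreover have "(\<exists>r\<in>R. r < j) \<longleftrightarrow> (\<exists>r\<in>R. r < i)" using assms by force
  ultimately show "pool_lower R j = pool_lower R i" using 1 by (simp add: pool_lower_def)
qed

lemma pool_lower_Suc: "i \<in> R \<Longrightarrow> pool_lower R (Suc i) = real i"
proof -
  assume "i \<in> R"
  then have "Max {r \<in> R. r < Suc i} = i" by (intro Max_eqI) auto
  with \<open>i \<in> R\<close> show ?thesis by (auto simp: pool_lower_def)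
qed

lemma pool_sum_0 [simp]: "pool_sum R 0 = 0"
  by (simp add: pool_sum_def pool_lower_def)

lemma pool_sum_Suc:
  assumes "n \<in> R" "i < n"
  shows "i \<notin> R \<Longrightarrow> pool_sum R (Suc i) = pool_sum R i"
    and "i \<in> R \<Longrightarrow> pool_sum R i < pool_sum R (Suc i)"
proof -
  assume "i \<notin> R"
  then have "\<forall>r\<in>R. \<not> (i \<le> r \<and> r < Suc i)" by (metis less_Suc_eq_le le_antisym)
  then show "pool_sum R (Suc i) = pool_sum R i"
    using pool_eq[of n R i "Suc i"] assms by (simp add: pool_sum_def)
next
  assume i: "i \<in> R"
  show "pool_sum R i < pool_sum R (Suc i)"
    using pool_lower_Suc[OF i] pool_upper_self[OF i] pool_lower_le[of R i]
      pool_upper(2)[of n R "Suc i"] assms by (simp add: pool_sum_def)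
qed

text \<open>Pools (a, b] above r contribute (b - a)(b + a) = b^2 - a^2 and telescope; the product at
  the end corrects for the pool that r cuts in two. It vanishes for r in \<open>R\<close>. So
  \<open>pool_sum R\<close> meets the majorization constraint with equality at its own break points,
  which is what allows multiples of it to be subtracted.\<close>

lemma sum_pool_sum:
  assumes "n \<in> R" "r \<le> n"
  shows "(\<Sum>i\<in>{r<..n}. pool_sum R i) =
    real n ^ 2 - real r ^ 2 - (real (pool_upper R r) - real r) * (real r - pool_lower R r)"
  using assms(2)
proof (induction r rule: inc_induct)
  case base
  then show ?case using pool_upper_self[OF assms(1)] by simp
next
  case (step r)
  have "{r<..n} = insert (Suc r) {Suc r<..n}" using step by auto
  then have S: "(\<Sum>i\<in>{r<..n}. pool_sum R i) = pool_sum R (Suc r) + (\<Sum>i\<in>{Suc r<..n}. pool_sum R i)"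
    by simp
  show ?case
  proof (cases "r \<in> R")
    case True
    show ?thesis
      unfolding S step.IH pool_sum_def[of R "Suc r"] pool_lower_Suc[OF True] pool_upper_self[OF True]
      by (simp add: algebra_simps power2_eq_square)
  next
    case False
    then have "\<forall>q\<in>R. \<not> (r \<le> q \<and> q < Suc r)" by (metis less_Suc_eq_le le_antisym)
    then have e: "pool_upper R (Suc r) = pool_upper R r" "pool_lower R (Suc r) = pool_lower R r"
      using pool_eq[of n R r "Suc r"] assms step by auto
    show ?thesis
      unfolding S step.IH pool_sum_def[of R "Suc r"] e
      by (simp add: algebra_simps power2_eq_square)
  qed
qed

text \<open>Greedy decomposition: subtract as large a multiple of the finest admissible step function as
  monotonicity allows; then some jump vanishes, and the corresponding break point is dropped for
  the rest of the construction.\<close>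

lemma step_function_mixture:
  fixes s :: "nat \<Rightarrow> real" and u v :: real
  assumes "R \<subseteq> {..n}" "n \<in> R" "u \<le> v" "s 0 = 0"
    and "\<And>i. i < n \<Longrightarrow> s i \<le> s (Suc i)"
    and "\<And>i. i < n \<Longrightarrow> i \<notin> R \<Longrightarrow> s (Suc i) = s i"
    and "\<And>r. r \<in> R \<Longrightarrow> (\<Sum>i\<in>{r<..n}. s i) \<le> real n ^ 2 - real r ^ 2"
  shows "\<exists>Q. (\<forall>\<omega>. Q \<omega> \<subseteq> R \<and> n \<in> Q \<omega>) \<and> antimono Q \<and>
           (\<forall>i\<le>n. ((\<lambda>\<omega>. pool_sum (Q \<omega>) i) has_integral (v - u) * s i) {u..v})"
  using assms
proof (induction "card R" arbitrary: R s u v rule: less_induct)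
  case less
  note R = less.prems(1,2) and uv = less.prems(3) and s0 = less.prems(4)
    and mono = less.prems(5) and flat = less.prems(6) and maj = less.prems(7)
  have fin: "finite R" using R(1) finite_subset by blast
  define J where "J i = s (Suc i) - s i" for i
  define K where "K i = pool_sum R (Suc i) - pool_sum R i" for i
  have K: "i < n \<Longrightarrow> i \<in> R \<Longrightarrow> K i > 0" "i < n \<Longrightarrow> i \<notin> R \<Longrightarrow> K i = 0" for i
    using pool_sum_Suc[OF R(2)] by (auto simp: K_def)
  show ?case
  proof (cases "\<forall>i<n. K i \<le> J i")
    \<comment> \<open>Terminal case: comparing jumps gives \<open>pool_sum R \<le> s\<close>, while
      the constraint at the least break point bounds the total of \<open>s\<close> by that of
      \<open>pool_sum R\<close>. The two functions therefore agree, and \<open>R\<close> is used on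
      all that is left of the interval.\<close>
    case True
    have ge: "pool_sum R i \<le> s i" if "i \<le> n" for i
      using that
    proof (induction i)
      case (Suc i)
      then show ?case using True[rule_format, of i] by (simp add: J_def K_def)
    qed (simp add: s0)
    define r0 where "r0 = Min R"
    have r0: "r0 \<in> R" "r0 \<le> n" "\<And>r. r \<in> R \<Longrightarrow> r0 \<le> r"
      unfolding r0_def using fin R Min_in Min_le by auto
    have eq: "s i = pool_sum R i" if "i \<le> n" for i
    proof (cases "i \<le> r0")
      case True
      then have "s i = 0 \<and> pool_sum R i = 0"
      proof (induction i)
        case (Suc i)
        then have "i \<notin> R" "i < n" using r0 by force+
        then show ?case using Suc flat pool_sum_Suc(1)[OF R(2)] by simp
      qed (simp add: s0)
      then show ?thesis by simp
    next
      case False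
      have "(\<Sum>i\<in>{r0<..n}. s i) \<le> (\<Sum>i\<in>{r0<..n}. pool_sum R i)"
        using maj[OF r0(1)] sum_pool_sum[OF R(2) r0(2)] pool_upper_self[OF r0(1)] by simp
      then have "(\<Sum>i\<in>{r0<..n}. s i - pool_sum R i) = 0"
        using sum_nonneg[of "{r0<..n}" "\<lambda>i. s i - pool_sum R i"] ge
        by (simp add: sum_subtractf)
      then have "\<forall>i\<in>{r0<..n}. s i - pool_sum R i = 0"
        by (subst (asm) sum_nonneg_eq_0_iff) (use ge in auto)
      then show ?thesis using False that by auto
    qed
    show ?thesis
    proof (intro exI[of _ "\<lambda>_. R"] conjI allI impI)
      show "((\<lambda>\<omega>. pool_sum R i) has_integral (v - u) * s i) {u..v}" if "i \<le> n" for i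
        using has_integral_const_real[of "pool_sum R i" u v] uv eq[OF that] by simp
    qed (use R in \<open>auto simp: antimono_def\<close>)
  next
    case False
    define C where "C = {i \<in> R. i < n}"
    have J0: "J i \<ge> 0" if "i < n" for i using mono[OF that] by (simp add: J_def)
    obtain i0 where i0: "i0 < n" "J i0 < K i0" using False by force
    then have "i0 \<in> C" using K(2)[of i0] J0[of i0] by (force simp: C_def)
    have "finite C" using fin by (simp add: C_def)
    \<comment> \<open>The largest weight for which \<open>s - l * pool_sum R\<close> stays
      nondecreasing; at the minimising \<open>k\<close> its jump vanishes. Only break points below
      \<open>n\<close> compete, so \<open>n\<close> is never dropped.\<close>
    define l where "l = Min ((\<lambda>i. J i / K i) ` C)"
    have l_le: "l \<le> J i / K i" if "i \<in> C" for i
      unfolding l_def using that \<open>finite C\<close> by auto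
    have "l \<in> (\<lambda>i. J i / K i) ` C"
      unfolding l_def using \<open>finite C\<close> \<open>i0 \<in> C\<close> by (intro Min_in) auto
    then obtain k where k: "k \<in> C" "l = J k / K k" by auto
    have kn: "k < n" "k \<in> R" "K k > 0" using k K(1) by (auto simp: C_def)
    have l0: "0 \<le> l" using k kn J0 by simp
    have "J i0 / K i0 < 1" using i0 K(1) \<open>i0 \<in> C\<close> by (simp add: C_def divide_less_eq)
    then have l1: "l < 1" using l_le[OF \<open>i0 \<in> C\<close>] by simp
    have lK: "l * K i \<le> J i" if "i < n" for i
    proof (cases "i \<in> R")
      case True
      then show ?thesis using l_le[of i] K(1)[of i] that by (simp add: C_def le_divide_eq)
    next
      case False
      then show ?thesis using K(2) J0 that by simp
    qed
    \<comment> \<open>The remainder is rescaled to total weight one. Because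
      \<open>pool_sum R\<close> attains the bound \<open>n ^ 2 - r ^ 2\<close> at every r in
      \<open>R\<close>, the rescaled remainder satisfies the same bound there.\<close>
    define t where "t i = (s i - l * pool_sum R i) / (1 - l)" for i
    have t_Suc: "t (Suc i) - t i = (J i - l * K i) / (1 - l)" for i
      by (simp add: t_def J_def K_def diff_divide_distrib[symmetric] algebra_simps)
    define w where "w = u + l * (v - u)"
    have uw: "u \<le> w" using l0 uv by (simp add: w_def)
    have "l * (v - u) \<le> 1 * (v - u)" using l1 uv by (intro mult_right_mono) auto
    then have wv: "w \<le> v" by (simp add: w_def)
    have "\<exists>Q. (\<forall>\<omega>. Q \<omega> \<subseteq> R - {k} \<and> n \<in> Q \<omega>) \<and> antimono Q \<and>
           (\<forall>i\<le>n. ((\<lambda>\<omega>. pool_sum (Q \<omega>) i) has_integral (v - w) * t i) {w..v})"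
    proof (rule less.hyps)
      show "card (R - {k}) < card R" using kn fin by (intro psubset_card_mono) auto
      show "R - {k} \<subseteq> {..n}" "n \<in> R - {k}" using R kn by auto
      show "w \<le> v" by fact
      show "t 0 = 0" by (simp add: t_def s0)
      show "t i \<le> t (Suc i)" if "i < n" for i
      proof -
        have "0 \<le> (J i - l * K i) / (1 - l)" using lK[OF that] l1 by (intro divide_nonneg_pos) auto
        then show ?thesis using t_Suc[of i] by linarith
      qed
      show "t (Suc i) = t i" if "i < n" "i \<notin> R - {k}" for i
      proof -
        have "J i = l * K i"
        proof (cases "i = k")
          case True
          then show ?thesis using k kn by simp
        next
          case False
          then show ?thesis using that flat[of i] K(2)[of i] by (simp add: J_def)
        qed
        then show ?thesis using t_Suc[of i] by simp
      qed
      show "(\<Sum>i\<in>{r<..n}. t i) \<le> real n ^ 2 - real r ^ 2" if "r \<in> R - {k}" for r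
      proof -
        have r: "r \<in> R" "r \<le> n" using that R by auto
        have "(\<Sum>i\<in>{r<..n}. t i) = ((\<Sum>i\<in>{r<..n}. s i) - l * (\<Sum>i\<in>{r<..n}. pool_sum R i)) / (1 - l)"
          by (simp add: t_def sum_divide_distrib[symmetric] sum_subtractf sum_distrib_left)
        also have "\<dots> \<le> ((real n ^ 2 - real r ^ 2) - l * (real n ^ 2 - real r ^ 2)) / (1 - l)"
          using maj[OF r(1)] sum_pool_sum[OF R(2) r(2)] pool_upper_self[OF r(1)] l1
          by (intro divide_right_mono) auto
        also have "\<dots> = real n ^ 2 - real r ^ 2"
          using l1 by (simp add: field_simps)
        finally show ?thesis .
      qed
    qed
    then obtain Q where Q: "\<And>\<omega>. Q \<omega> \<subseteq> R - {k}" "\<And>\<omega>. n \<in> Q \<omega>" "antimono Q"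
      "\<And>i. i \<le> n \<Longrightarrow> ((\<lambda>\<omega>. pool_sum (Q \<omega>) i) has_integral (v - w) * t i) {w..v}" by blast
    \<comment> \<open>The finer partition \<open>R\<close> occupies the first part of the interval,
      of relative length \<open>l\<close>, and subsets of \<open>R - {k}\<close> follow; this order
      makes the family of break sets decreasing.\<close>
    define P where "P \<omega> = (if \<omega> < w then R else Q \<omega>)" for \<omega>
    have "((\<lambda>\<omega>. pool_sum (P \<omega>) i) has_integral (v - u) * s i) {u..v}" if "i \<le> n" for i
    proof -
      have "((\<lambda>\<omega>. pool_sum (P \<omega>) i) has_integral (w - u) * pool_sum R i) {u..w}"
      proof (rule has_integral_spike_finite)
        show "((\<lambda>_. pool_sum R i) has_integral (w - u) * pool_sum R i) {u..w}"
          using has_integral_const_real[of "pool_sum R i" u w] uw by simp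
        show "pool_sum (P \<omega>) i = pool_sum R i" if "\<omega> \<in> {u..w} - {w}" for \<omega>
          using that by (simp add: P_def)
      qed simp
      moreover have "((\<lambda>\<omega>. pool_sum (P \<omega>) i) has_integral (v - w) * t i) {w..v}"
        by (rule has_integral_eq[OF _ Q(4)[OF that]]) (auto simp: P_def)
      ultimately have "((\<lambda>\<omega>. pool_sum (P \<omega>) i) has_integral
          (w - u) * pool_sum R i + (v - w) * t i) {u..v}"
        using has_integral_combine[OF uw wv] by blast
      moreover have "v - w = (1 - l) * (v - u)" by (simp add: w_def algebra_simps)
      then have "(v - w) * t i = (v - u) * (s i - l * pool_sum R i)" using l1 by (simp add: t_def)
      then have "(w - u) * pool_sum R i + (v - w) * t i = (v - u) * s i"
        by (simp add: w_def algebra_simps)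
      ultimately show ?thesis by simp
    qed
    moreover have "antimono P"
    proof (rule antimonoI)
      fix x y :: real assume "x \<le> y"
      then show "P y \<subseteq> P x" using Q(1)[of y] antimonoD[OF Q(3), of x y] by (auto simp: P_def)
    qed
    moreover have "P \<omega> \<subseteq> R \<and> n \<in> P \<omega>" for \<omega> using Q R by (auto simp: P_def)
    ultimately show ?thesis by blast
  qed
qed

section \<open>Compactness\<close>

text \<open>A cluster point \<open>l\<close> of the sequence in the compact product becomes a limit
  along the filter generated by the tails and the preimages under \<open>g\<close> of the
  neighbourhoods of \<open>l\<close>. That filter plays the role of a subnet, for an index type of
  any cardinality.\<close>

lemma Tychonoff_subfilter:
  fixes g :: "nat \<Rightarrow> 'i \<Rightarrow> 'b::topological_space"
  assumes "compact K" and "\<And>n i. g n i \<in> K"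
  obtains H l where "H \<noteq> bot" "H \<le> sequentially" "\<And>i. ((\<lambda>n. g n i) \<longlongrightarrow> l i) H"
proof -
  have "compactin (product_topology (\<lambda>_. euclidean) UNIV) (PiE UNIV (\<lambda>_::'i. K))"
    by (subst compactin_PiE) (simp add: assms(1))
  then have "compact (PiE UNIV (\<lambda>_::'i. K))"
    unfolding euclidean_product_topology by simp
  moreover have "filtermap g sequentially \<noteq> bot"
    by (simp add: filtermap_bot_iff)
  moreover have "eventually (\<lambda>x. x \<in> PiE UNIV (\<lambda>_::'i. K)) (filtermap g sequentially)"
    using assms(2) by (simp add: eventually_filtermap PiE_UNIV_domain)
  ultimately obtain l where l: "inf (nhds l) (filtermap g sequentially) \<noteq> bot"
    unfolding compact_filter by blast
  define H where "H = inf sequentially (filtercomap g (nhds l))"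
  have "H \<noteq> bot"
  proof
    assume "H = bot"
    then have "eventually (\<lambda>_. False) H" by simp
    then obtain P Q where P: "eventually P sequentially"
      and Q: "eventually Q (filtercomap g (nhds l))" and PQ: "\<And>n. P n \<Longrightarrow> Q n \<Longrightarrow> False"
      unfolding H_def eventually_inf by blast
    obtain Q' where Q': "eventually Q' (nhds l)" "\<And>n. Q' (g n) \<Longrightarrow> Q n"
      using Q unfolding eventually_filtercomap by blast
    have "eventually (\<lambda>x. \<not> Q' x) (filtermap g sequentially)"
      unfolding eventually_filtermap using P by eventually_elim (use PQ Q' in blast)
    with Q'(1) have "eventually (\<lambda>_. False) (inf (nhds l) (filtermap g sequentially))"
      unfolding eventually_inf by (intro exI[of _ Q'] exI[of _ "\<lambda>x. \<not> Q' x"]) auto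
    with l show False by (simp add: eventually_False)
  qed
  moreover have "H \<le> sequentially" by (simp add: H_def)
  moreover have "((\<lambda>n. g n i) \<longlongrightarrow> l i) H" for i
  proof -
    have "filterlim g (nhds l) H"
      unfolding filterlim_iff_le_filtercomap H_def by simp
    moreover have "open {x::'i \<Rightarrow> 'b. x i \<in> S}" if "open S" for S
      using open_vimage[OF that, of "\<lambda>x. x i"] by (simp add: vimage_def)
    ultimately show ?thesis
      by (force simp: tendsto_def)
  qed
  ultimately show thesis using that by blast
qed

text \<open>Left and right sums enclose the integral, and their difference telescopes to
  \<open>(h 1 - h 0) / N\<close>. The error thus depends on \<open>h\<close> only through its values
  at the two ends.\<close>

lemma Riemann_sum_mono:
  fixes h :: "real \<Rightarrow> real"
  assumes h: "mono_on {0..1} h" and N: "0 < (N::nat)"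
  shows "\<bar>integral {0..1} h - (\<Sum>k<N. h (real k / real N)) / real N\<bar> \<le> (h 1 - h 0) / real N"
proof -
  have int: "h integrable_on {u..v}" if "0 \<le> u" "v \<le> 1" for u v
    using that h by (intro integrable_on_mono_on) (auto simp: mono_on_def)
  have bound: "(\<Sum>k<m. h (real k / real N)) / real N \<le> integral {0..real m / real N} h \<and>
      integral {0..real m / real N} h \<le> (\<Sum>k<m. h (real (Suc k) / real N)) / real N" if "m \<le> N" for m :: nat
    using that
  proof (induction m)
    case (Suc m)
    have le: "real m / real N \<le> real (Suc m) / real N" "real (Suc m) / real N \<le> 1" "0 \<le> real m / real N"
      using Suc N by (auto simp: divide_right_mono)
    have "integral {0..real (Suc m) / real N} h = integral {0..real m / real N} h + integral {real m / real N..real (Suc m) / real N} h"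
      using le int by (intro Henstock_Kurzweil_Integration.integral_combine[symmetric]) auto
    moreover have bd: "h (real m / real N) \<le> h x" "h x \<le> h (real (Suc m) / real N)"
      if "x \<in> {real m / real N..real (Suc m) / real N}" for x
    proof -
      have "0 \<le> x" "x \<le> 1" using that le by (meson atLeastAtMost_iff order_trans)+
      then show "h (real m / real N) \<le> h x" "h x \<le> h (real (Suc m) / real N)"
        using that le by (auto intro!: mono_onD[OF h] simp del: of_nat_Suc)
    qed
    have "integral {real m / real N..real (Suc m) / real N} (\<lambda>_. h (real m / real N))
        \<le> integral {real m / real N..real (Suc m) / real N} h"
      using le int bd by (intro integral_le) auto
    moreover have "integral {real m / real N..real (Suc m) / real N} h
        \<le> integral {real m / real N..real (Suc m) / real N} (\<lambda>_. h (real (Suc m) / real N))"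
      using le int bd by (intro integral_le) auto
    moreover have "real (Suc m) / real N - real m / real N = 1 / real N" by (simp add: diff_divide_distrib[symmetric])
    ultimately show ?case using Suc le by (simp add: add_divide_distrib)
  qed simp
  have "(\<Sum>k<N. h (real (Suc k) / real N)) - (\<Sum>k<N. h (real k / real N)) = h 1 - h 0"
    using sum_lessThan_telescope[of "\<lambda>k. h (real k / N)" N] N by (simp add: sum_subtractf)
  then have "(\<Sum>k<N. h (real (Suc k) / real N)) / real N - (\<Sum>k<N. h (real k / real N)) / real N = (h 1 - h 0) / real N"
    by (simp add: diff_divide_distrib[symmetric])
  then show ?thesis using bound[of N] N by auto
qed

text \<open>A substitute for dominated convergence, which fails along general filters: the Riemann sums
  of monotone functions converge at a uniform rate.\<close>

lemma tendsto_integral_mono_on: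
  fixes g :: "'i \<Rightarrow> real \<Rightarrow> real"
  assumes mono: "\<And>n. mono_on {0..1} (g n)" and bd: "\<And>n x. x \<in> {0..1} \<Longrightarrow> \<bar>g n x\<bar> \<le> 1"
    and lim: "\<And>x. x \<in> {0..1} \<Longrightarrow> ((\<lambda>n. g n x) \<longlongrightarrow> l x) H" and H: "H \<noteq> bot"
  shows "mono_on {0..1} l" and "((\<lambda>n. integral {0..1} (g n)) \<longlongrightarrow> integral {0..1} l) H"
proof -
  show l_mono: "mono_on {0..1} l"
  proof (rule mono_onI)
    fix r t :: real assume "r \<in> {0..1}" "t \<in> {0..1}" "r \<le> t"
    then show "l r \<le> l t"
      using mono by (intro tendsto_le[OF H lim lim]) (auto simp: mono_on_def)
  qed
  have l_bd: "\<bar>l x\<bar> \<le> 1" if "x \<in> {0..1}" for x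
    using tendsto_upperbound[OF tendsto_rabs[OF lim[OF that]] _ H] bd[OF that] by simp
  show "((\<lambda>n. integral {0..1} (g n)) \<longlongrightarrow> integral {0..1} l) H"
  proof (rule tendstoI)
    fix e :: real assume "0 < e"
    \<comment> \<open>Values in [-1, 1] give a Riemann error of at most \<open>2 / N\<close>, which
      is below \<open>e / 3\<close> for this \<open>N\<close>. The remaining third is spent on the
      convergence of the finite sums.\<close>
    obtain N :: nat where N: "6 / e < N" using reals_Archimedean2 by blast
    then have N0: "0 < N" using \<open>0 < e\<close> by (metis divide_pos_pos less_trans of_nat_0_less_iff zero_less_numeral)
    define L where "L h = (\<Sum>k<N. h (real k / N)) / real N" for h :: "real \<Rightarrow> real"
    have small: "\<bar>integral {0..1} h - L h\<bar> < e / 3"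
      if "mono_on {0..1} h" "\<And>x. x \<in> {0..1} \<Longrightarrow> \<bar>h x\<bar> \<le> 1" for h
    proof -
      have "\<bar>integral {0..1} h - L h\<bar> \<le> (h 1 - h 0) / N"
        unfolding L_def by (rule Riemann_sum_mono[OF that(1) N0])
      also have "\<dots> \<le> 2 / N"
        using that(2)[of 1] that(2)[of 0] by (intro divide_right_mono) auto
      also have "\<dots> < e / 3" using N N0 \<open>0 < e\<close> by (simp add: field_simps)
      finally show ?thesis .
    qed
    have "((\<lambda>n. L (g n)) \<longlongrightarrow> L l) H"
      unfolding L_def using N0 by (intro tendsto_divide tendsto_sum lim tendsto_const) auto
    then have "eventually (\<lambda>n. dist (L (g n)) (L l) < e / 3) H"
      using \<open>0 < e\<close> by (intro tendstoD) auto
    then show "eventually (\<lambda>n. dist (integral {0..1} (g n)) (integral {0..1} l) < e) H"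
    proof eventually_elim
      case (elim n)
      then show ?case
        using small[OF mono bd, of n] small[OF l_mono l_bd] unfolding dist_real_def by linarith
    qed
  qed
qed

text \<open>The end points of a pool containing rank \<open>p\<close>, with (-b, b) for the excluded
  pool. All inequalities are weak so that the condition is closed; \<open>fst I = snd I\<close> is
  allowed and means full separation at \<open>p\<close>.\<close>

definition bracket :: "real \<Rightarrow> real \<times> real \<Rightarrow> bool" where
  "bracket p I \<longleftrightarrow> fst I \<le> p \<and> p \<le> snd I \<and> snd I \<le> 1 \<and> (0 \<le> fst I \<or> fst I = - snd I)"

text \<open>Closed as well, being a union of two closed conditions. An excluded interval has a
  negative lower end, so among intervals that bracket positive ranks it can be preceded only by
  itself: exclusion hits a lower set of types without a separate clause.\<close>

definition precedes :: "real \<times> real \<Rightarrow> real \<times> real \<Rightarrow> bool" where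
  "precedes I J \<longleftrightarrow> snd I \<le> fst J \<or> I = J"

lemma bracket_tendsto:
  assumes "(I \<longlongrightarrow> J) H" "(p \<longlongrightarrow> q) H" "H \<noteq> bot" "eventually (\<lambda>n. bracket (p n) (I n)) H"
  shows "bracket q J"
proof -
  have "closed {x :: real \<times> real \<times> real. bracket (fst x) (snd x)}"
    unfolding bracket_def
    by (intro closed_Collect_conj closed_Collect_disj closed_Collect_le closed_Collect_eq continuous_intros)
  then have "(q, J) \<in> {x. bracket (fst x) (snd x)}"
    by (rule Lim_in_closed_set[of _ "\<lambda>n. (p n, I n)" H]) (use assms in \<open>auto intro!: tendsto_Pair\<close>)
  then show ?thesis by simp
qed

lemma precedes_tendsto:
  assumes "(I \<longlongrightarrow> I') H" "(J \<longlongrightarrow> J') H" "H \<noteq> bot" "eventually (\<lambda>n. precedes (I n) (J n)) H"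
  shows "precedes I' J'"
proof -
  have "closed {x :: (real \<times> real) \<times> (real \<times> real). precedes (fst x) (snd x)}"
    unfolding precedes_def
    by (intro closed_Collect_disj closed_Collect_le closed_Collect_eq continuous_intros)
  then have "(I', J') \<in> {x. precedes (fst x) (snd x)}"
    by (rule Lim_in_closed_set[of _ "\<lambda>n. (I n, J n)" H]) (use assms in \<open>auto intro!: tendsto_Pair\<close>)
  then show ?thesis by simp
qed

text \<open>Type 0 is left out: its rank 0 lies in none of the half-open grid cells, and it has mass
  zero.\<close>

definition pooling :: "real \<Rightarrow> (real \<Rightarrow> real) \<Rightarrow> (real \<Rightarrow> real \<times> real) \<Rightarrow> bool" where
  "pooling tb F I \<longleftrightarrow> (\<forall>\<theta>\<in>{0<..tb}. bracket (F \<theta>) (I \<theta>)) \<and>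
     (\<forall>\<theta>\<in>{0<..tb}. \<forall>\<theta>'\<in>{0<..tb}. \<theta> < \<theta>' \<longrightarrow> precedes (I \<theta>) (I \<theta>'))"

section \<open>Pooling structures obtained from grids and their limits\<close>

lemma pool_upper_antimono:
  assumes "R' \<subseteq> R" "n \<in> R'" "i \<le> n"
  shows "pool_upper R i \<le> pool_upper R' i"
  using pool_upper(1,2)[OF assms(2,3)] assms(1) by (intro pool_upper_le) auto

text \<open>Fewer break points enlarge the pools. The encoding of exclusion respects this: once the
  last break point below \<open>i\<close> is gone, the lower end falls to \<open>-b\<close>, and it
  keeps falling as the upper end \<open>b\<close> grows.\<close>

lemma pool_lower_mono:
  assumes "R' \<subseteq> R" "n \<in> R'" "i \<le> n"
  shows "pool_lower R' i \<le> pool_lower R i"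
proof (rule pool_lower_cases[of R' i])
  fix r assume "r \<in> R'" "r < i" "pool_lower R' i = real r"
  then show ?thesis using pool_lower_ge[of r R i] assms(1) by auto
next
  assume *: "pool_lower R' i = - real (pool_upper R' i)"
  show ?thesis
    using pool_upper_antimono[OF assms] by (rule_tac pool_lower_cases[of R i]) (simp_all add: *)
qed

lemma pooling_grid:
  assumes n: "0 < n" "n \<in> R"
    and F: "\<And>\<theta>. \<theta> \<in> {0<..tb} \<Longrightarrow> 0 < F \<theta> \<and> F \<theta> \<le> 1"
    and F_mono: "\<And>\<theta> \<theta>'. \<theta> \<in> {0<..tb} \<Longrightarrow> \<theta>' \<in> {0<..tb} \<Longrightarrow> \<theta> < \<theta>' \<Longrightarrow> F \<theta> \<le> F \<theta>'"
  shows "pooling tb F (\<lambda>\<theta>. (pool_lower R (nat \<lceil>n * F \<theta>\<rceil>) / n, pool_upper R (nat \<lceil>n * F \<theta>\<rceil>) / n))"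
proof -
  define i where "i \<theta> = nat \<lceil>n * F \<theta>\<rceil>" for \<theta>
  have i: "0 < i \<theta>" "i \<theta> \<le> n" "real (i \<theta>) - 1 < n * F \<theta>" "n * F \<theta> \<le> real (i \<theta>)"
    if "\<theta> \<in> {0<..tb}" for \<theta>
  proof -
    have "0 < n * F \<theta>" using F[OF that] n by simp
    moreover have "n * F \<theta> \<le> n" using F[OF that] n by simp
    ultimately show "0 < i \<theta>" "i \<theta> \<le> n" "real (i \<theta>) - 1 < n * F \<theta>" "n * F \<theta> \<le> real (i \<theta>)"
      unfolding i_def by linarith+
  qed
  have "bracket (F \<theta>) (pool_lower R (i \<theta>) / n, pool_upper R (i \<theta>) / n)" if "\<theta> \<in> {0<..tb}" for \<theta>
  proof -
    note U = pool_upper[OF n(2) i(2)[OF that]]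
    have "pool_lower R (i \<theta>) \<le> n * F \<theta>"
    proof (rule pool_lower_cases[of R "i \<theta>"])
      fix r assume "r < i \<theta>" "pool_lower R (i \<theta>) = real r"
      then show ?thesis using i(3)[OF that] by linarith
    next
      assume "pool_lower R (i \<theta>) = - real (pool_upper R (i \<theta>))"
      moreover have "0 \<le> n * F \<theta>" using F[OF that] by simp
      ultimately show ?thesis by linarith
    qed
    moreover have "n * F \<theta> \<le> pool_upper R (i \<theta>)" using U i(4)[OF that] by linarith
    moreover have "0 \<le> pool_lower R (i \<theta>) \<or> pool_lower R (i \<theta>) = - pool_upper R (i \<theta>)"
      by (rule pool_lower_cases[of R "i \<theta>"]) auto
    ultimately show ?thesis
      using n U(3) by (auto simp: bracket_def field_simps)
  qed
  moreover have "precedes (pool_lower R (i \<theta>) / n, pool_upper R (i \<theta>) / n)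
      (pool_lower R (i \<theta>') / n, pool_upper R (i \<theta>') / n)"
    if *: "\<theta> \<in> {0<..tb}" "\<theta>' \<in> {0<..tb}" "\<theta> < \<theta>'" for \<theta> \<theta>'
  proof -
    have ij: "i \<theta> \<le> i \<theta>'"
      unfolding i_def using F_mono[OF *] n by (intro nat_mono ceiling_mono mult_left_mono) auto
    show ?thesis
    proof (cases "\<exists>r\<in>R. i \<theta> \<le> r \<and> r < i \<theta>'")
      case True
      then obtain r where r: "r \<in> R" "i \<theta> \<le> r" "r < i \<theta>'" by blast
      have "real (pool_upper R (i \<theta>)) \<le> pool_lower R (i \<theta>')"
        using pool_upper_le[OF r(1,2)] pool_lower_ge[OF r(1,3)] by linarith
      then show ?thesis using n by (auto simp: precedes_def divide_right_mono)
    next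
      case False
      then show ?thesis
        using pool_eq[OF n(2) ij i(2)[OF *(2)]] by (auto simp: precedes_def)
    qed
  qed
  ultimately show ?thesis unfolding pooling_def i_def by auto
qed

text \<open>\<open>c i\<close> is the status wanted on the cell (i / n, (i + 1) / n]. The bound
  \<open>maj\<close> is the majorization inequality from rank r / n upwards, multiplied by
  2n^2.\<close>

lemma step_pooling:
  fixes c :: "nat \<Rightarrow> real"
  assumes n: "0 < n"
    and F: "\<And>\<theta>. \<theta> \<in> {0<..tb} \<Longrightarrow> 0 < F \<theta> \<and> F \<theta> \<le> 1"
    and F_mono: "\<And>\<theta> \<theta>'. \<theta> \<in> {0<..tb} \<Longrightarrow> \<theta>' \<in> {0<..tb} \<Longrightarrow> \<theta> < \<theta>' \<Longrightarrow> F \<theta> \<le> F \<theta>'"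
    and c: "0 \<le> c 0" "\<And>i. Suc i < n \<Longrightarrow> c i \<le> c (Suc i)"
    and maj: "\<And>r. r \<le> n \<Longrightarrow> 2 * real n * (\<Sum>i\<in>{r..<n}. c i) \<le> real n ^ 2 - real r ^ 2"
  obtains I :: "real \<Rightarrow> real \<Rightarrow> real \<times> real" where
    "\<And>\<omega>. pooling tb F (\<lambda>\<theta>. I \<theta> \<omega>)"
    "\<And>\<theta>. \<theta> \<in> {0<..tb} \<Longrightarrow> mono (\<lambda>\<omega>. - fst (I \<theta> \<omega>))"
    "\<And>\<theta>. \<theta> \<in> {0<..tb} \<Longrightarrow> mono (\<lambda>\<omega>. snd (I \<theta> \<omega>))"
    "\<And>\<theta>. \<theta> \<in> {0<..tb} \<Longrightarrow>
       ((\<lambda>\<omega>. fst (I \<theta> \<omega>) + snd (I \<theta> \<omega>)) has_integral 2 * c (nat \<lceil>n * F \<theta>\<rceil> - 1)) {0..1}"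
proof -
  \<comment> \<open>Cells are numbered from 1, hence the shift; rank 0 is a dummy with the value 0
    that the mixture lemma expects. The factor turns a status into a sum of unscaled end
    points.\<close>
  define S where "S i = (if i = 0 then 0 else 2 * real n * c (i - 1))" for i
  have "\<exists>Q. (\<forall>\<omega>. Q \<omega> \<subseteq> {..n} \<and> n \<in> Q \<omega>) \<and> antimono Q \<and>
           (\<forall>i\<le>n. ((\<lambda>\<omega>. pool_sum (Q \<omega>) i) has_integral (1 - 0) * S i) {0::real..1})"
  proof (rule step_function_mixture)
    show "S i \<le> S (Suc i)" if "i < n" for i
      using that c n by (cases i) (auto simp: S_def)
    show "(\<Sum>i\<in>{r<..n}. S i) \<le> real n ^ 2 - real r ^ 2" if "r \<in> {..n}" for r
    proof -
      have "{r<..n} = {Suc r..<Suc n}" by auto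
      then have "(\<Sum>i\<in>{r<..n}. S i) = (\<Sum>i\<in>{r..<n}. 2 * real n * c i)"
        by (simp only: sum.shift_bounds_Suc_ivl) (simp add: S_def)
      then show ?thesis using maj[of r] that by (simp add: sum_distrib_left)
    qed
  qed (auto simp: S_def)
  then obtain Q where Q: "\<And>\<omega>. n \<in> Q \<omega>" "antimono Q"
    "\<And>i. i \<le> n \<Longrightarrow> ((\<lambda>\<omega>. pool_sum (Q \<omega>) i) has_integral S i) {0::real..1}" by auto
  define i where "i \<theta> = nat \<lceil>n * F \<theta>\<rceil>" for \<theta>
  have i: "0 < i \<theta>" "i \<theta> \<le> n" if "\<theta> \<in> {0<..tb}" for \<theta>
  proof -
    have "0 < n * F \<theta>" using F[OF that] n by simp
    moreover have "n * F \<theta> \<le> n" using F[OF that] n by simp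
    ultimately show "0 < i \<theta>" "i \<theta> \<le> n" unfolding i_def by linarith+
  qed
  show thesis
  proof (rule that[of "\<lambda>\<theta> \<omega>. (pool_lower (Q \<omega>) (i \<theta>) / n, pool_upper (Q \<omega>) (i \<theta>) / n)"])
    show "pooling tb F (\<lambda>\<theta>. (pool_lower (Q \<omega>) (i \<theta>) / n, pool_upper (Q \<omega>) (i \<theta>) / n))" for \<omega>
      unfolding i_def by (rule pooling_grid[OF n Q(1) F F_mono])
  next
    fix \<theta> assume \<theta>: "\<theta> \<in> {0<..tb}"
    show "mono (\<lambda>\<omega>. - fst (pool_lower (Q \<omega>) (i \<theta>) / n, real (pool_upper (Q \<omega>) (i \<theta>)) / n))"
      using pool_lower_mono[OF antimonoD[OF Q(2)] Q(1) i(2)[OF \<theta>]]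
      by (auto intro!: monoI divide_right_mono)
    show "mono (\<lambda>\<omega>. snd (pool_lower (Q \<omega>) (i \<theta>) / n, real (pool_upper (Q \<omega>) (i \<theta>)) / n))"
      using pool_upper_antimono[OF antimonoD[OF Q(2)] Q(1) i(2)[OF \<theta>]]
      by (auto intro!: monoI divide_right_mono)
    have "((\<lambda>\<omega>. pool_sum (Q \<omega>) (i \<theta>) / n) has_integral S (i \<theta>) / n) {0..1}"
      by (intro has_integral_divide Q(3) i \<theta>)
    then show "((\<lambda>\<omega>. fst (pool_lower (Q \<omega>) (i \<theta>) / n, real (pool_upper (Q \<omega>) (i \<theta>)) / n) +
        snd (pool_lower (Q \<omega>) (i \<theta>) / n, real (pool_upper (Q \<omega>) (i \<theta>)) / n))
        has_integral 2 * c (nat \<lceil>n * F \<theta>\<rceil> - 1)) {0..1}"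
      using n i(1)[OF \<theta>]
      by (simp add: S_def pool_sum_def add_divide_distrib i_def[symmetric])
  qed
qed

text \<open>On the grid with n + 1 cells, \<theta> receives the value of \<open>s\<close> at a type
  strictly below \<theta> whose rank is at most 1 / (n + 1) smaller. In the limit this confines
  \<open>J \<theta>\<close> between the left limit of \<open>s\<close> at \<theta> and
  \<open>s \<theta>\<close>, and nothing sharper is claimed at a jump.\<close>

lemma limit_pooling:
  fixes F q s :: "real \<Rightarrow> real"
  assumes F: "strict_mono_on {0..tb} F" "F 0 = 0" "F tb = 1" and tb: "0 < tb"
    and q: "\<And>p. p \<in> {0..1} \<Longrightarrow> q p \<in> {0..tb} \<and> F (q p) = p"
    and s: "mono_on {0..tb} s" "0 \<le> s 0"
    and maj: "\<And>n r. r \<le> n \<Longrightarrow> 2 * real n * (\<Sum>i\<in>{r..<n}. s (q (real i / real n))) \<le> real n ^ 2 - real r ^ 2"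
  obtains I :: "real \<Rightarrow> real \<Rightarrow> real \<times> real" and J :: "real \<Rightarrow> real" where
    "\<And>\<omega>. \<omega> \<in> {0..1} \<Longrightarrow> pooling tb F (\<lambda>\<theta>. I \<theta> \<omega>)"
    "\<And>\<theta>. \<theta> \<in> {0<..tb} \<Longrightarrow> mono_on {0..1} (\<lambda>\<omega>. - fst (I \<theta> \<omega>))"
    "\<And>\<theta>. \<theta> \<in> {0<..tb} \<Longrightarrow> mono_on {0..1} (\<lambda>\<omega>. snd (I \<theta> \<omega>))"
    "\<And>\<theta>. \<theta> \<in> {0<..tb} \<Longrightarrow> ((\<lambda>\<omega>. fst (I \<theta> \<omega>) + snd (I \<theta> \<omega>)) has_integral 2 * J \<theta>) {0..1}"
    "\<And>\<theta>. \<theta> \<in> {0<..tb} \<Longrightarrow> J \<theta> \<le> s \<theta>"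
    "\<And>\<theta> \<theta>'. 0 \<le> \<theta>' \<Longrightarrow> \<theta>' < \<theta> \<Longrightarrow> \<theta> \<le> tb \<Longrightarrow> s \<theta>' \<le> J \<theta>"
proof -
  have F_less: "F x < F y \<longleftrightarrow> x < y" if "x \<in> {0..tb}" "y \<in> {0..tb}" for x y
    using strict_mono_on_less[OF F(1)] that by blast
  have F01: "0 < F \<theta> \<and> F \<theta> \<le> 1" if "\<theta> \<in> {0<..tb}" for \<theta>
    using F_less[of 0 \<theta>] F_less[of tb \<theta>] that F by auto
  have F_mono: "F \<theta> \<le> F \<theta>'" if "\<theta> \<in> {0<..tb}" "\<theta>' \<in> {0<..tb}" "\<theta> < \<theta>'" for \<theta> \<theta>'
    using F_less[of \<theta> \<theta>'] that by auto
  have q_less: "q p < \<theta> \<longleftrightarrow> p < F \<theta>" "\<theta> < q p \<longleftrightarrow> F \<theta> < p" if "p \<in> {0..1}" "\<theta> \<in> {0..tb}" for p \<theta>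
    using F_less[of "q p" \<theta>] F_less[of \<theta> "q p"] q[OF that(1)] that by auto
  have "q 0 = 0"
    using q_less[of 0 0] q[of 0] tb F by (auto simp: order_le_less)
  have "\<exists>I. (\<forall>\<omega>. pooling tb F (\<lambda>\<theta>. I \<theta> \<omega>)) \<and>
      (\<forall>\<theta>\<in>{0<..tb}. mono (\<lambda>\<omega>. - fst (I \<theta> \<omega>)) \<and> mono (\<lambda>\<omega>. snd (I \<theta> \<omega>)) \<and>
        ((\<lambda>\<omega>. fst (I \<theta> \<omega>) + snd (I \<theta> \<omega>)) has_integral
          2 * s (q (real (nat \<lceil>Suc n * F \<theta>\<rceil> - 1) / Suc n))) {0..1::real})" for n
  proof (rule step_pooling[of "Suc n" tb F "\<lambda>i. s (q (real i / real (Suc n)))"])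
    show "0 \<le> s (q (real 0 / real (Suc n)))" using \<open>q 0 = 0\<close> s by simp
    show "s (q (real i / real (Suc n))) \<le> s (q (real (Suc i) / real (Suc n)))" if "Suc i < Suc n" for i
    proof (rule mono_onD[OF s(1)])
      have *: "real i / real (Suc n) \<in> {0..1}" "real (Suc i) / real (Suc n) \<in> {0..1}"
        "real i / real (Suc n) < real (Suc i) / real (Suc n)"
        using that by (auto simp: field_simps)
      then show "q (real i / real (Suc n)) \<in> {0..tb}" "q (real (Suc i) / real (Suc n)) \<in> {0..tb}"
        using q by auto
      then show "q (real i / real (Suc n)) \<le> q (real (Suc i) / real (Suc n))"
        using q_less(1)[of "real i / real (Suc n)" "q (real (Suc i) / real (Suc n))"] q * by simp
    qed
    show "2 * real (Suc n) * (\<Sum>i = r..<Suc n. s (q (real i / real (Suc n)))) \<le> (real (Suc n))\<^sup>2 - (real r)\<^sup>2"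
      if "r \<le> Suc n" for r
      by (rule maj[OF that])
  next
    fix I :: "real \<Rightarrow> real \<Rightarrow> real \<times> real"
    assume "\<And>\<omega>. pooling tb F (\<lambda>\<theta>. I \<theta> \<omega>)"
      "\<And>\<theta>. \<theta> \<in> {0<..tb} \<Longrightarrow> mono (\<lambda>\<omega>. - fst (I \<theta> \<omega>))"
      "\<And>\<theta>. \<theta> \<in> {0<..tb} \<Longrightarrow> mono (\<lambda>\<omega>. snd (I \<theta> \<omega>))"
      "\<And>\<theta>. \<theta> \<in> {0<..tb} \<Longrightarrow> ((\<lambda>\<omega>. fst (I \<theta> \<omega>) + snd (I \<theta> \<omega>)) has_integral
          2 * s (q (real (nat \<lceil>Suc n * F \<theta>\<rceil> - 1) / Suc n))) {0..1::real}"
    then show ?thesis by (intro exI[of _ I]) simp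
  qed (use F01 F_mono in blast)+
  then have "\<forall>n. \<exists>I. (\<forall>\<omega>. pooling tb F (\<lambda>\<theta>. I \<theta> \<omega>)) \<and>
      (\<forall>\<theta>\<in>{0<..tb}. mono (\<lambda>\<omega>. - fst (I \<theta> \<omega>)) \<and> mono (\<lambda>\<omega>. snd (I \<theta> \<omega>)) \<and>
        ((\<lambda>\<omega>. fst (I \<theta> \<omega>) + snd (I \<theta> \<omega>)) has_integral
          2 * s (q (real (nat \<lceil>Suc n * F \<theta>\<rceil> - 1) / Suc n))) {0..1::real})" ..
  then obtain I where "\<forall>n. (\<forall>\<omega>. pooling tb F (\<lambda>\<theta>. I n \<theta> \<omega>)) \<and>
      (\<forall>\<theta>\<in>{0<..tb}. mono (\<lambda>\<omega>. - fst (I n \<theta> \<omega>)) \<and> mono (\<lambda>\<omega>. snd (I n \<theta> \<omega>)) \<and>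
        ((\<lambda>\<omega>. fst (I n \<theta> \<omega>) + snd (I n \<theta> \<omega>)) has_integral
          2 * s (q (real (nat \<lceil>Suc n * F \<theta>\<rceil> - 1) / Suc n))) {0..1::real})"
    by (rule choice[THEN exE])
  then have I: "\<And>n \<omega>. pooling tb F (\<lambda>\<theta>. I n \<theta> \<omega>)"
    "\<And>n \<theta>. \<theta> \<in> {0<..tb} \<Longrightarrow> mono (\<lambda>\<omega>. - fst (I n \<theta> \<omega>))"
    "\<And>n \<theta>. \<theta> \<in> {0<..tb} \<Longrightarrow> mono (\<lambda>\<omega>. snd (I n \<theta> \<omega>))"
    "\<And>n \<theta>. \<theta> \<in> {0<..tb} \<Longrightarrow> ((\<lambda>\<omega>. fst (I n \<theta> \<omega>) + snd (I n \<theta> \<omega>)) has_integral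
          2 * s (q (real (nat \<lceil>Suc n * F \<theta>\<rceil> - 1) / Suc n))) {0..1::real}"
    by auto
  \<comment> \<open>The default value keeps \<open>g\<close> inside the compact square on the whole
    index type, as the product argument demands.\<close>
  define g where "g n x = (if fst x \<in> {0<..tb} then I n (fst x) (snd x) else (0, 0))" for n x
  have I_bd: "\<bar>fst (I n \<theta> \<omega>)\<bar> \<le> 1" "\<bar>snd (I n \<theta> \<omega>)\<bar> \<le> 1" if "\<theta> \<in> {0<..tb}" for n \<theta> \<omega>
    using I(1)[of n \<omega>] F01[OF that] that unfolding pooling_def bracket_def by fastforce+
  have "g n x \<in> {-1..1} \<times> {-1..1}" for n x
    using I_bd[of "fst x" n "snd x"] by (auto simp: g_def mem_Times_iff abs_le_iff)
  then obtain H l where H: "H \<noteq> bot" "H \<le> sequentially"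
    and l: "\<And>x. ((\<lambda>n. g n x) \<longlongrightarrow> l x) H"
    using Tychonoff_subfilter[of "{-1..1::real} \<times> {-1..1::real}" g] by (metis compact_Icc compact_Times)
  have lim: "((\<lambda>n. I n \<theta> \<omega>) \<longlongrightarrow> l (\<theta>, \<omega>)) H" if "\<theta> \<in> {0<..tb}" for \<theta> \<omega>
    using l[of "(\<theta>, \<omega>)"] that by (simp add: g_def)
  define J where "J \<theta> = integral {0..1} (\<lambda>\<omega>. fst (l (\<theta>, \<omega>)) + snd (l (\<theta>, \<omega>))) / 2" for \<theta>
  \<comment> \<open>Lower ends decrease in \<omega> while upper ends increase, so their sum need not
    be monotone. The convergence of integrals is therefore applied to each end separately, with a
    sign for the lower one.\<close>
  have A: "mono_on {0..1} (\<lambda>\<omega>. - fst (l (\<theta>, \<omega>)))"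
    "((\<lambda>n. integral {0..1} (\<lambda>\<omega>. - fst (I n \<theta> \<omega>))) \<longlongrightarrow> integral {0..1} (\<lambda>\<omega>. - fst (l (\<theta>, \<omega>)))) H"
    if "\<theta> \<in> {0<..tb}" for \<theta>
  proof -
    have m: "mono_on {0..1} (\<lambda>\<omega>. - fst (I n \<theta> \<omega>))" for n
      using I(2)[OF that] by (auto simp: mono_on_def mono_def)
    have bd: "\<bar>- fst (I n \<theta> \<omega>)\<bar> \<le> 1" for n \<omega> using I_bd(1)[OF that] by simp
    note * = tendsto_integral_mono_on[where g = "\<lambda>n \<omega>. - fst (I n \<theta> \<omega>)",
        OF m bd tendsto_minus[OF tendsto_fst[OF lim[OF that]]] H(1)]
    show "mono_on {0..1} (\<lambda>\<omega>. - fst (l (\<theta>, \<omega>)))" by (rule *(1))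
    show "((\<lambda>n. integral {0..1} (\<lambda>\<omega>. - fst (I n \<theta> \<omega>))) \<longlongrightarrow> integral {0..1} (\<lambda>\<omega>. - fst (l (\<theta>, \<omega>)))) H"
      by (rule *(2))
  qed
  have B: "mono_on {0..1} (\<lambda>\<omega>. snd (l (\<theta>, \<omega>)))"
    "((\<lambda>n. integral {0..1} (\<lambda>\<omega>. snd (I n \<theta> \<omega>))) \<longlongrightarrow> integral {0..1} (\<lambda>\<omega>. snd (l (\<theta>, \<omega>)))) H"
    if "\<theta> \<in> {0<..tb}" for \<theta>
  proof -
    have m: "mono_on {0..1} (\<lambda>\<omega>. snd (I n \<theta> \<omega>))" for n
      using I(3)[OF that] by (auto simp: mono_on_def mono_def)
    note * = tendsto_integral_mono_on[where g = "\<lambda>n \<omega>. snd (I n \<theta> \<omega>)",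
        OF m I_bd(2)[OF that] tendsto_snd[OF lim[OF that]] H(1)]
    show "mono_on {0..1} (\<lambda>\<omega>. snd (l (\<theta>, \<omega>)))" by (rule *(1))
    show "((\<lambda>n. integral {0..1} (\<lambda>\<omega>. snd (I n \<theta> \<omega>))) \<longlongrightarrow> integral {0..1} (\<lambda>\<omega>. snd (l (\<theta>, \<omega>)))) H"
      by (rule *(2))
  qed
  have split: "integral {0..1} (\<lambda>\<omega>. a \<omega> + b \<omega>) =
      integral {0..1} b - integral {0..1} (\<lambda>\<omega>. - a \<omega>)" and integ: "(\<lambda>\<omega>. a \<omega> + b \<omega>) integrable_on {0..1}"
    if "mono_on {0..1} (\<lambda>\<omega>. - a \<omega>)" "mono_on {0..1} b" for a b :: "real \<Rightarrow> real"
  proof -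
    have "(\<lambda>\<omega>. - a \<omega>) integrable_on {0..1}" "b integrable_on {0..1}"
      using that by (auto intro: integrable_on_mono_on)
    then show "integral {0..1} (\<lambda>\<omega>. a \<omega> + b \<omega>) = integral {0..1} b - integral {0..1} (\<lambda>\<omega>. - a \<omega>)"
      "(\<lambda>\<omega>. a \<omega> + b \<omega>) integrable_on {0..1}"
      using Henstock_Kurzweil_Integration.integral_diff[of b "{0..1}" "\<lambda>\<omega>. - a \<omega>"]
        integrable_diff[of b "{0..1}" "\<lambda>\<omega>. - a \<omega>"] by (simp_all add: add.commute)
  qed
  define j where "j n \<theta> = q (real (nat \<lceil>Suc n * F \<theta>\<rceil> - 1) / Suc n)" for n \<theta>
  have J: "((\<lambda>n. s (j n \<theta>)) \<longlongrightarrow> J \<theta>) H" if "\<theta> \<in> {0<..tb}" for \<theta>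
  proof -
    have m: "mono_on {0..1} (\<lambda>\<omega>. - fst (I n \<theta> \<omega>))" "mono_on {0..1} (\<lambda>\<omega>. snd (I n \<theta> \<omega>))" for n
      using I(2,3)[OF that] by (auto simp: mono_on_def mono_def)
    have "integral {0..1} (\<lambda>\<omega>. snd (I n \<theta> \<omega>)) - integral {0..1} (\<lambda>\<omega>. - fst (I n \<theta> \<omega>)) = 2 * s (j n \<theta>)" for n
      using integral_unique[OF I(4)[OF that]] split[OF m] by (simp add: j_def)
    moreover have "integral {0..1} (\<lambda>\<omega>. snd (l (\<theta>, \<omega>))) - integral {0..1} (\<lambda>\<omega>. - fst (l (\<theta>, \<omega>))) = 2 * J \<theta>"
      using split[OF A(1)[OF that] B(1)[OF that]] by (simp add: J_def)
    ultimately have "((\<lambda>n. 2 * s (j n \<theta>)) \<longlongrightarrow> 2 * J \<theta>) H"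
      using tendsto_diff[OF B(2)[OF that] A(2)[OF that]] by (simp only:)
    then have "((\<lambda>n. 2 * s (j n \<theta>) / 2) \<longlongrightarrow> 2 * J \<theta> / 2) H"
      by (intro tendsto_divide tendsto_const) auto
    then show ?thesis by simp
  qed
  have j: "j n \<theta> \<in> {0..tb}" "j n \<theta> < \<theta>"
    "\<And>\<theta>'. \<theta>' \<in> {0..tb} \<Longrightarrow> 1 / Suc n < F \<theta> - F \<theta>' \<Longrightarrow> \<theta>' < j n \<theta>" if "\<theta> \<in> {0<..tb}" for n \<theta>
  proof -
    define m where "m = nat \<lceil>Suc n * F \<theta>\<rceil>"
    have "0 < Suc n * F \<theta>" "Suc n * F \<theta> \<le> Suc n" using F01[OF that] by auto
    then have m: "0 < m" "m \<le> Suc n" "real m - 1 < Suc n * F \<theta>" "Suc n * F \<theta> \<le> real m"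
      unfolding m_def by linarith+
    \<comment> \<open>The left end of the cell that contains \<open>F \<theta>\<close>. Cells are
      open on the left, which makes \<open>p < F \<theta>\<close> and hence
      \<open>j n \<theta> < \<theta>\<close> strict.\<close>
    define p where "p = real (m - 1) / Suc n"
    have "F \<theta> \<le> real m / Suc n"
      using m(4) by (subst pos_le_divide_eq) (auto simp: mult.commute)
    moreover have pm: "p = real m / Suc n - 1 / Suc n"
      using m by (simp add: p_def of_nat_diff diff_divide_distrib)
    ultimately have p3: "F \<theta> - 1 / Suc n \<le> p" by simp
    have "p = (real m - 1) / Suc n" by (simp only: pm diff_divide_distrib)
    then have "p < F \<theta>" "p \<in> {0..1}"
      using m F01[OF that] by (auto simp del: of_nat_Suc simp: pos_divide_less_eq mult.commute divide_le_eq)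
    note p = this(2,1) p3
    have jp: "j n \<theta> = q p" by (simp add: j_def p_def m_def)
    show "j n \<theta> \<in> {0..tb}" "j n \<theta> < \<theta>" using q[OF p(1)] q_less(1)[OF p(1), of \<theta>] p that by (auto simp: jp)
    show "\<theta>' < j n \<theta>" if "\<theta>' \<in> {0..tb}" "1 / Suc n < F \<theta> - F \<theta>'" for \<theta>'
      using q_less(2)[OF p(1) that(1)] that p by (simp add: jp)
  qed
  show thesis
  proof (rule that[of "\<lambda>\<theta> \<omega>. l (\<theta>, \<omega>)" J])
    show "pooling tb F (\<lambda>\<theta>. l (\<theta>, \<omega>))" for \<omega>
      unfolding pooling_def
    proof (intro conjI ballI impI)
      show "bracket (F \<theta>) (l (\<theta>, \<omega>))" if "\<theta> \<in> {0<..tb}" for \<theta>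
        using I(1) that by (intro bracket_tendsto[OF lim[OF that] tendsto_const H(1)]) (auto simp: pooling_def)
      show "precedes (l (\<theta>, \<omega>)) (l (\<theta>', \<omega>))"
        if "\<theta> \<in> {0<..tb}" "\<theta>' \<in> {0<..tb}" "\<theta> < \<theta>'" for \<theta> \<theta>'
        using I(1) that
        by (intro precedes_tendsto[OF lim[OF that(1)] lim[OF that(2)] H(1)]) (auto simp: pooling_def)
    qed
  next
    fix \<theta> assume \<theta>: "\<theta> \<in> {0<..tb}"
    show "mono_on {0..1} (\<lambda>\<omega>. - fst (l (\<theta>, \<omega>)))" "mono_on {0..1} (\<lambda>\<omega>. snd (l (\<theta>, \<omega>)))"
      using A(1) B(1) \<theta> by auto
    show "((\<lambda>\<omega>. fst (l (\<theta>, \<omega>)) + snd (l (\<theta>, \<omega>))) has_integral 2 * J \<theta>) {0..1}"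
      using integ[OF A(1) B(1), OF \<theta> \<theta>] by (simp add: J_def has_integral_integral)
    show "J \<theta> \<le> s \<theta>"
      using j(1,2)[OF \<theta>] \<theta> by (intro tendsto_upperbound[OF J[OF \<theta>] _ H(1)] always_eventually allI mono_onD[OF s(1)])
        (auto intro: less_imp_le)
  next
    fix \<theta> \<theta>' assume *: "0 \<le> \<theta>'" "\<theta>' < \<theta>" "\<theta> \<le> tb"
    then have \<theta>: "\<theta> \<in> {0<..tb}" "\<theta>' \<in> {0..tb}" by auto
    have "0 < F \<theta> - F \<theta>'" using F_less[of \<theta>' \<theta>] * by auto
    then have "eventually (\<lambda>n. 1 / Suc n < F \<theta> - F \<theta>') sequentially"
      using order_tendstoD(2)[OF LIMSEQ_inverse_real_of_nat] by (simp add: inverse_eq_divide)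
    then have "eventually (\<lambda>n. 1 / Suc n < F \<theta> - F \<theta>') H"
      using H(2) filter_leD by blast
    then have "eventually (\<lambda>n. s \<theta>' \<le> s (j n \<theta>)) H"
    proof eventually_elim
      case (elim n)
      then have "\<theta>' \<le> j n \<theta>" by (intro less_imp_le j(3)[OF \<theta>])
      then show ?case using j(1)[OF \<theta>(1)] \<theta>(2) by (intro mono_onD[OF s(1)])
    qed
    then show "s \<theta>' \<le> J \<theta>" by (rule tendsto_lowerbound[OF J[OF \<theta>(1)] _ H(1)])
  qed
qed

section \<open>Left limits of pooling structures\<close>

text \<open>\<open>dyadic_below k \<theta>\<close> increases to \<open>\<theta>\<close> strictly from the left; it takes countably many values, so
  composing with it turns separate measurability into joint measurability.\<close>

definition dyadic_below :: "nat \<Rightarrow> real \<Rightarrow> real" where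
  "dyadic_below k \<theta> = (real_of_int \<lceil>2 ^ k * \<theta>\<rceil> - 1) / 2 ^ k"

lemma dyadic_below_less: "dyadic_below k \<theta> < \<theta>"
proof -
  have "real_of_int \<lceil>2 ^ k * \<theta>\<rceil> - 1 < 2 ^ k * \<theta>" by linarith
  then show ?thesis by (simp add: dyadic_below_def divide_less_eq mult.commute)
qed

lemma dyadic_below_ge: "\<theta> - 1 / 2 ^ k \<le> dyadic_below k \<theta>"
proof -
  have "(2 ^ k * \<theta> - 1) / 2 ^ k \<le> (real_of_int \<lceil>2 ^ k * \<theta>\<rceil> - 1) / 2 ^ k"
    by (intro divide_right_mono) (linarith, simp)
  then show ?thesis by (simp add: dyadic_below_def diff_divide_distrib)
qed

lemma dyadic_below_Suc: "dyadic_below k \<theta> \<le> dyadic_below (Suc k) \<theta>"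
proof -
  have "2 * \<lceil>2 ^ k * \<theta>\<rceil> - 1 \<le> \<lceil>2 * (2 ^ k * \<theta>)\<rceil>" by linarith
  then have "2 * \<lceil>2 ^ k * \<theta>\<rceil> - 2 \<le> \<lceil>2 ^ Suc k * \<theta>\<rceil> - 1" by (simp add: mult.assoc)
  then have "real_of_int (2 * \<lceil>2 ^ k * \<theta>\<rceil> - 2) \<le> real_of_int (\<lceil>2 ^ Suc k * \<theta>\<rceil> - 1)"
    by (simp only: of_int_le_iff)
  then have "real_of_int (2 * \<lceil>2 ^ k * \<theta>\<rceil> - 2) / 2 ^ Suc k \<le> real_of_int (\<lceil>2 ^ Suc k * \<theta>\<rceil> - 1) / 2 ^ Suc k"
    by (intro divide_right_mono) auto
  moreover have "real_of_int (2 * \<lceil>2 ^ k * \<theta>\<rceil> - 2) / 2 ^ Suc k = dyadic_below k \<theta>"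
    by (simp add: dyadic_below_def field_simps)
  ultimately show ?thesis by (simp add: dyadic_below_def)
qed

lemma dyadic_below_mono: "j \<le> k \<Longrightarrow> dyadic_below j \<theta> \<le> dyadic_below k \<theta>"
  by (rule lift_Suc_mono_le[of "\<lambda>k. dyadic_below k \<theta>"]) (rule dyadic_below_Suc)

lemma half_powers: "(\<lambda>k. 1 / 2 ^ k :: real) \<longlonglongrightarrow> 0"
  using LIMSEQ_power_zero[of "1 / 2 :: real"] by (simp add: power_divide)

lemma dyadic_below_tendsto: "(\<lambda>k. dyadic_below k \<theta>) \<longlonglongrightarrow> \<theta>"
proof (rule tendsto_sandwich)
  show "(\<lambda>k. \<theta> - 1 / 2 ^ k) \<longlonglongrightarrow> \<theta>" using tendsto_diff[OF tendsto_const half_powers] by simp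
  show "\<forall>\<^sub>F k in sequentially. \<theta> - 1 / 2 ^ k \<le> dyadic_below k \<theta>" using dyadic_below_ge by simp
  show "\<forall>\<^sub>F k in sequentially. dyadic_below k \<theta> \<le> \<theta>"
    using dyadic_below_less by (simp add: less_imp_le)
qed simp

lemma eventually_dyadic_below: "c < \<theta> \<Longrightarrow> eventually (\<lambda>k. c < dyadic_below k \<theta>) sequentially"
  using order_tendstoD(1)[OF dyadic_below_tendsto] .

text \<open>If \<open>snd (I \<theta>) \<le> fst (I \<theta>')\<close>, then all four end points are
  in order, because a bracket has its lower end below its upper end. This monotonicity is the reason
  why left limits in the type exist.\<close>

lemma pooling_mono:
  assumes "pooling tb F I" "\<theta> \<in> {0<..tb}" "\<theta>' \<in> {0<..tb}" "\<theta> \<le> \<theta>'"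
  shows "fst (I \<theta>) \<le> fst (I \<theta>')" "snd (I \<theta>) \<le> snd (I \<theta>')"
proof -
  have "bracket (F \<theta>) (I \<theta>)" "bracket (F \<theta>') (I \<theta>')" "\<theta> < \<theta>' \<Longrightarrow> precedes (I \<theta>) (I \<theta>')"
    using assms by (auto simp: pooling_def)
  then show "fst (I \<theta>) \<le> fst (I \<theta>')" "snd (I \<theta>) \<le> snd (I \<theta>')"
    using assms(4) by (cases "\<theta> = \<theta>'"; force simp: bracket_def precedes_def)+
qed

definition left_limit :: "(real \<Rightarrow> real \<times> real) \<Rightarrow> real \<Rightarrow> real \<times> real" where
  "left_limit I \<theta> = lim (\<lambda>k. I (dyadic_below k \<theta>))"

lemma left_limit_tendsto:
  assumes P: "pooling tb F I" and \<theta>: "\<theta> \<in> {0<..tb}"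
  shows "(\<lambda>k. I (dyadic_below k \<theta>)) \<longlonglongrightarrow> left_limit I \<theta>"
proof -
  obtain K where K: "\<And>k. K \<le> k \<Longrightarrow> 0 < dyadic_below k \<theta>"
    using eventually_dyadic_below[of 0 \<theta>] \<theta> unfolding eventually_sequentially by auto
  have in_dom: "dyadic_below (k + K) \<theta> \<in> {0<..tb}" for k
    using K[of "k + K"] dyadic_below_less[of "k + K" \<theta>] \<theta> by auto
  \<comment> \<open>The shift by \<open>K\<close> discards the initial approximants that may fall
    outside the domain {0<..tb}.\<close>
  define J where "J k = I (dyadic_below (k + K) \<theta>)" for k
  have mono: "incseq (\<lambda>k. fst (J k))" "incseq (\<lambda>k. snd (J k))"
    unfolding incseq_def J_def
    using pooling_mono[OF P in_dom in_dom] dyadic_below_mono by auto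
  have bd: "snd (J k) \<le> 1" "fst (J k) \<le> snd (J k)" for k
  proof -
    have "bracket (F (dyadic_below (k + K) \<theta>)) (J k)"
      using P in_dom[of k] unfolding pooling_def J_def by blast
    then show "snd (J k) \<le> 1" "fst (J k) \<le> snd (J k)" by (auto simp: bracket_def)
  qed
  have "fst (J k) \<le> 1" for k using bd[of k] by linarith
  with mono(1) obtain a where a: "(\<lambda>k. fst (J k)) \<longlonglongrightarrow> a"
    by (rule incseq_convergent[rule_format])
  from mono(2) bd(1) obtain b where b: "(\<lambda>k. snd (J k)) \<longlonglongrightarrow> b"
    by (rule incseq_convergent[rule_format])
  have "J \<longlonglongrightarrow> (a, b)" using tendsto_Pair[OF a b] by simp
  then have "(\<lambda>k. I (dyadic_below k \<theta>)) \<longlonglongrightarrow> (a, b)"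
    unfolding J_def by (rule LIMSEQ_offset)
  then show ?thesis unfolding left_limit_def by (simp add: limI)
qed

text \<open>Both defining conditions are closed, and continuity of \<open>F\<close> lets the rank
  move along with its interval. For \<open>\<theta> < \<theta>'\<close> the approximants of
  \<theta>' eventually exceed \<theta>, hence also those of \<theta>, so the order survives.\<close>

lemma pooling_left_limit:
  assumes P: "pooling tb F I" and F: "continuous_on {0..tb} F"
  shows "pooling tb F (left_limit I)"
proof -
  have dom: "eventually (\<lambda>k. dyadic_below k \<theta> \<in> {0<..tb}) sequentially" if "\<theta> \<in> {0<..tb}" for \<theta>
    using eventually_dyadic_below[of 0 \<theta>] that
    by (auto elim!: eventually_mono simp: less_imp_le intro: order_trans[OF less_imp_le[OF dyadic_below_less]])
  show ?thesis
    unfolding pooling_def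
  proof (intro conjI ballI impI)
    fix \<theta> assume \<theta>: "\<theta> \<in> {0<..tb}"
    have "(\<lambda>k. F (dyadic_below k \<theta>)) \<longlonglongrightarrow> F \<theta>"
      using F \<theta> dyadic_below_tendsto eventually_mono[OF dom[OF \<theta>]]
      by (intro continuous_within_tendsto_compose[of \<theta> "{0..tb}" F]) (auto simp: continuous_on_eq_continuous_within)
    then show "bracket (F \<theta>) (left_limit I \<theta>)"
      by (rule bracket_tendsto[OF left_limit_tendsto[OF P \<theta>]])
        (use dom[OF \<theta>] P in \<open>auto elim!: eventually_mono simp: pooling_def\<close>)
  next
    fix \<theta> \<theta>' assume *: "\<theta> \<in> {0<..tb}" "\<theta>' \<in> {0<..tb}" "\<theta> < \<theta>'"
    have "eventually (\<lambda>k. precedes (I (dyadic_below k \<theta>)) (I (dyadic_below k \<theta>'))) sequentially"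
      using dom[OF *(1)] dom[OF *(2)] eventually_dyadic_below[OF *(3)]
    proof eventually_elim
      case (elim k)
      then show ?case using P dyadic_below_less[of k \<theta>] unfolding pooling_def by (meson less_trans)
    qed
    then show "precedes (left_limit I \<theta>) (left_limit I \<theta>')"
      by (intro precedes_tendsto[OF left_limit_tendsto[OF P *(1)] left_limit_tendsto[OF P *(2)]]) auto
  qed
qed

section \<open>Statuses and the type distribution\<close>

locale type_distribution =
  fixes tb :: real and f F :: "real \<Rightarrow> real"
  assumes tb_pos: "0 < tb"
    and f_cont: "continuous_on {0..tb} f"
    and f_pos: "\<forall>\<theta>\<in>{0..tb}. f \<theta> > 0"
    and f_prob: "(LINT \<theta>:{0..tb}|lborel. f \<theta>) = 1"
    and F_def: "\<forall>x\<in>{0..tb}. F x = (LINT \<theta>:{0..x}|lborel. f \<theta>)"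
begin

section \<open>The type distribution as a measure on the line\<close>

definition dens :: "real \<Rightarrow> real" where
  "dens \<theta> = indicator {0..tb} \<theta> * f \<theta>"

definition M :: "real measure" where
  "M = density lborel (\<lambda>\<theta>. ennreal (dens \<theta>))"

lemma f_set_integrable: "set_integrable lborel {0..tb} f"
  by (rule borel_integrable_atLeastAtMost'[OF f_cont])

lemma integrable_dens [simp]: "integrable lborel dens"
  using f_set_integrable by (simp add: set_integrable_def dens_def[abs_def])

lemma dens_measurable [measurable]: "dens \<in> borel_measurable borel"
  using borel_measurable_integrable[OF integrable_dens] by simp

lemma dens_nonneg: "0 \<le> dens \<theta>"
  using f_pos by (auto simp: dens_def indicator_def intro: less_imp_le)

lemma sets_M [measurable_cong, simp]: "sets M = sets borel"
  by (simp add: M_def)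

lemma space_M [simp]: "space M = UNIV"
  by (simp add: M_def)

lemma set_integral_M:
  assumes [measurable]: "A \<in> sets borel" "(\<lambda>\<theta>. indicator A \<theta> * g \<theta>) \<in> borel_measurable borel"
    and "A \<subseteq> {0..tb}"
  shows "(LINT \<theta>:A|lborel. g \<theta> * f \<theta>) = (LINT \<theta>:A|M. g \<theta>)"
proof -
  have "(LINT \<theta>:A|M. g \<theta>) = integral\<^sup>L M (\<lambda>\<theta>. indicator A \<theta> * g \<theta>)"
    by (simp add: set_lebesgue_integral_def)
  also have "\<dots> = integral\<^sup>L lborel (\<lambda>\<theta>. dens \<theta> * (indicator A \<theta> * g \<theta>))"
    unfolding M_def by (intro integral_real_density) (simp_all add: dens_nonneg)
  also have "\<dots> = (LINT \<theta>:A|lborel. g \<theta> * f \<theta>)"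
    unfolding set_lebesgue_integral_def
    using assms(3) by (intro Bochner_Integration.integral_cong) (auto simp: dens_def indicator_def)
  finally show ?thesis ..
qed

lemma measure_M:
  assumes [measurable]: "A \<in> sets borel" and "A \<subseteq> {0..tb}"
  shows "(LINT \<theta>:A|lborel. f \<theta>) = measure M A"
proof -
  have "(LINT \<theta>:A|lborel. 1 * f \<theta>) = (LINT \<theta>:A|M. 1)"
    by (rule set_integral_M) (use assms in auto)
  then show ?thesis by (simp add: set_lebesgue_integral_def)
qed

lemma emeasure_M_space: "emeasure M UNIV = 1"
proof -
  have "emeasure M UNIV = (\<integral>\<^sup>+\<theta>. ennreal (dens \<theta>) \<partial>lborel)"
    by (simp add: M_def emeasure_density)
  also have "\<dots> = ennreal (integral\<^sup>L lborel dens)"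
    by (rule nn_integral_eq_integral) (auto simp: dens_nonneg)
  also have "integral\<^sup>L lborel dens = 1"
    using f_prob by (simp add: set_lebesgue_integral_def dens_def[abs_def])
  finally show ?thesis by simp
qed

sublocale M: finite_measure M
  by (rule finite_measureI) (simp add: emeasure_M_space)

lemma measure_types: "measure M {0..tb} = 1"
  using measure_M[of "{0..tb}"] f_prob by simp

lemma measure_M_Diff:
  assumes [measurable]: "A \<in> sets borel" and "A \<subseteq> {0..tb}"
  shows "measure M ({0..tb} - A) = 1 - measure M A"
  using M.finite_measure_Diff[of "{0..tb}" A] assms measure_types by simp

lemma null_sets_M:
  assumes "countable N"
  shows "N \<in> null_sets M"
proof -
  have N: "N \<in> null_sets lborel" by (rule countable_imp_null_set_lborel[OF assms])
  then have "N \<in> sets lborel" by auto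
  with AE_not_in[OF N] show ?thesis
    unfolding M_def by (subst null_sets_density_iff) auto
qed

lemma F_has_derivative:
  assumes "x \<in> {0..tb}"
  shows "(F has_vector_derivative f x) (at x within {0..tb})"
proof -
  have eq: "F u = integral {0..u} f" if "u \<in> {0..tb}" for u
  proof -
    have "set_integrable lborel {0..u} f"
      using that by (intro set_integrable_subset[OF f_set_integrable]) auto
    then show ?thesis using F_def that by (simp add: set_borel_integral_eq_integral)
  qed
  show ?thesis
    using has_vector_derivative_transform[OF assms eq integral_has_vector_derivative[OF f_cont assms]]
    by blast
qed

lemma F_continuous: "continuous_on {0..tb} F"
  by (rule continuous_on_vector_derivative[OF F_has_derivative])

lemma F_ends: "F 0 = 0" "F tb = 1"
  using F_def f_prob tb_pos measure_M[of "{0..0}"] null_sets_M[of "{0}"]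
  by (auto simp: measure_eq_0_null_sets)

lemma F_strict_mono: "strict_mono_on {0..tb} F"
proof (rule strict_mono_onI)
  fix x y assume xy: "x \<in> {0..tb}" "y \<in> {0..tb}" "x < y"
  show "F x < F y"
  proof (rule DERIV_pos_imp_increasing_open[OF xy(3)])
    show "continuous_on {x..y} F"
      by (rule continuous_on_subset[OF F_continuous]) (use xy in auto)
    fix t assume "x < t" "t < y"
    then have t: "0 < t" "t < tb" using xy by auto
    then have "(F has_vector_derivative f t) (at t)"
      using F_has_derivative[of t] at_within_Icc_at[OF t] by simp
    then show "\<exists>d. DERIV F t :> d \<and> d > 0"
      using t f_pos by (intro exI[of _ "f t"]) (simp add: has_real_derivative_iff_has_vector_derivative)
  qed
qed

lemma F_less: "x \<in> {0..tb} \<Longrightarrow> y \<in> {0..tb} \<Longrightarrow> F x < F y \<longleftrightarrow> x < y"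
  using strict_mono_on_less[OF F_strict_mono] by blast

lemma F_le: "x \<in> {0..tb} \<Longrightarrow> y \<in> {0..tb} \<Longrightarrow> F x \<le> F y \<longleftrightarrow> x \<le> y"
  using F_less[of y x] by (auto simp: not_less[symmetric])

lemma F_bounds: "x \<in> {0..tb} \<Longrightarrow> F x \<in> {0..1}"
  using F_le[of 0 x] F_le[of x tb] F_ends tb_pos by auto

lemma F_surj:
  assumes "p \<in> {0..1}"
  obtains x where "x \<in> {0..tb}" "F x = p"
  using IVT'[of F 0 p tb] assms F_ends tb_pos F_continuous by auto

lemma measure_M_le_F: "x \<in> {0..tb} \<Longrightarrow> measure M {0..x} = F x"
  using F_def measure_M[of "{0..x}"] by auto

text \<open>Ranks are uniformly distributed: \<open>F\<close> maps {0..tb} increasingly onto {0..1},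
  so both sets are intervals starting at 0, and they differ by a single null point.\<close>

lemma measure_quantile:
  assumes "c \<in> {0..1}"
  shows "{\<theta>\<in>{0..tb}. F \<theta> \<le> c} \<in> sets borel" "measure M {\<theta>\<in>{0..tb}. F \<theta> \<le> c} = c"
    and "{\<theta>\<in>{0..tb}. F \<theta> < c} \<in> sets borel" "measure M {\<theta>\<in>{0..tb}. F \<theta> < c} = c"
proof -
  obtain x where x: "x \<in> {0..tb}" "F x = c" using F_surj[OF assms] .
  have le: "{\<theta>\<in>{0..tb}. F \<theta> \<le> c} = {0..x}"
    using F_le[OF _ x(1)] x by auto
  have lt: "{\<theta>\<in>{0..tb}. F \<theta> < c} = {0..x} - {x}"
    using F_less[OF _ x(1)] x by auto
  show "{\<theta>\<in>{0..tb}. F \<theta> \<le> c} \<in> sets borel" "{\<theta>\<in>{0..tb}. F \<theta> < c} \<in> sets borel"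
    unfolding le lt by auto
  show "measure M {\<theta>\<in>{0..tb}. F \<theta> \<le> c} = c" "measure M {\<theta>\<in>{0..tb}. F \<theta> < c} = c"
    unfolding le lt using x measure_M_le_F null_sets_M[of "{x}"]
    by (simp_all add: measure_Diff_null_set)
qed

text \<open>\<open>F ^ 2 / 2\<close> is a primitive of the integrand, since \<open>f\<close> is the
  derivative of \<open>F\<close>.\<close>

lemma integral_F_f:
  assumes "x \<in> {0..tb}"
  shows "(LINT \<theta>:{x..tb}|lborel. F \<theta> * f \<theta>) = (1 - F x ^ 2) / 2"
proof -
  have sub: "{x..tb} \<subseteq> {0..tb}" using assms by auto
  have "((\<lambda>\<theta>. F \<theta> * f \<theta>) has_integral F tb ^ 2 / 2 - F x ^ 2 / 2) {x..tb}"
  proof (rule fundamental_theorem_of_calculus)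
    show "x \<le> tb" using assms by simp
    fix \<theta> assume "\<theta> \<in> {x..tb}"
    then have "(F has_vector_derivative f \<theta>) (at \<theta> within {x..tb})"
      using has_vector_derivative_within_subset[OF F_has_derivative sub] sub by blast
    then show "((\<lambda>\<theta>. F \<theta> ^ 2 / 2) has_vector_derivative F \<theta> * f \<theta>) (at \<theta> within {x..tb})"
      unfolding has_real_derivative_iff_has_vector_derivative[symmetric]
      by (auto intro!: derivative_eq_intros)
  qed
  moreover have "set_integrable lborel {x..tb} (\<lambda>\<theta>. F \<theta> * f \<theta>)"
    by (intro borel_integrable_atLeastAtMost' continuous_on_mult
        continuous_on_subset[OF F_continuous sub] continuous_on_subset[OF f_cont sub])
  ultimately show ?thesis
    using F_ends by (simp add: set_borel_integral_eq_integral integral_unique diff_divide_distrib)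
qed

section \<open>Level distributions and statuses as masses of level sets\<close>

lemma levelG_eq:
  assumes "{\<theta>\<in>{0..tb}. X \<theta> \<omega> \<le> q} \<in> sets borel"
  shows "levelG tb f X \<omega> q = measure M {\<theta>\<in>{0..tb}. X \<theta> \<omega> \<le> q}"
  unfolding levelG_def by (rule measure_M[OF assms]) auto

text \<open>Along a sequence increasing to \<open>q\<close> the sublevel sets exhaust the strict
  one, so the left limit is continuity of the measure from below.\<close>

lemma levelG_left_eq:
  assumes meas: "\<And>q. {\<theta>\<in>{0..tb}. X \<theta> \<omega> \<le> q} \<in> sets borel"
  shows "levelG_left tb f X \<omega> q = measure M {\<theta>\<in>{0..tb}. X \<theta> \<omega> < q}"
proof -
  have "(levelG tb f X \<omega> \<longlongrightarrow> measure M {\<theta>\<in>{0..tb}. X \<theta> \<omega> < q}) (at_left q)"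
  proof (rule tendsto_at_left_sequentially)
    show "q - 1 < q" by simp
    fix S :: "nat \<Rightarrow> real" assume S: "\<And>n. S n < q" "incseq S" "S \<longlonglongrightarrow> q"
    define A where "A n = {\<theta>\<in>{0..tb}. X \<theta> \<omega> \<le> S n}" for n
    have "(\<lambda>n. measure M (A n)) \<longlonglongrightarrow> measure M (\<Union>n. A n)"
      using S(2) meas by (intro M.finite_Lim_measure_incseq)
        (auto simp: A_def incseq_def intro: order_trans)
    moreover have "(\<Union>n. A n) = {\<theta>\<in>{0..tb}. X \<theta> \<omega> < q}"
    proof (intro set_eqI iffI)
      fix \<theta> assume "\<theta> \<in> {\<theta>\<in>{0..tb}. X \<theta> \<omega> < q}"
      then show "\<theta> \<in> (\<Union>n. A n)"
        using eventually_happens[OF order_tendstoD(1)[OF S(3)], of "X \<theta> \<omega>"]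
        by (auto simp: A_def intro: less_imp_le)
    qed (use S(1) in \<open>auto simp: A_def intro: le_less_trans\<close>)
    ultimately show "(\<lambda>n. levelG tb f X \<omega> (S n)) \<longlonglongrightarrow> measure M {\<theta>\<in>{0..tb}. X \<theta> \<omega> < q}"
      using levelG_eq[where X = X, OF meas] by (simp add: A_def)
  qed
  then show ?thesis
    unfolding levelG_left_def by (intro tendsto_Lim) simp
qed

lemma status_eq:
  assumes "\<And>q. {\<theta>\<in>{0..tb}. X \<theta> \<omega> \<le> q} \<in> sets borel"
  shows "status tb f X \<omega> q = (if q = 0 then 0 else
    (measure M {\<theta>\<in>{0..tb}. X \<theta> \<omega> < q} + measure M {\<theta>\<in>{0..tb}. X \<theta> \<omega> \<le> q}) / 2)"
  unfolding status_def using levelG_eq[where X = X, OF assms] levelG_left_eq[where X = X, OF assms] by simp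

text \<open>Up to a countable set, \<open>A\<close> lies between two sets of mass c. Types with
  \<open>F \<theta> = c\<close> may fall on either side, which suits brackets that are only weak at
  their ends.\<close>

lemma measure_sandwich:
  assumes c: "c \<in> {0..1}" and A: "A \<in> sets borel" "A \<subseteq> {0..tb}" and N: "countable N"
    and lower: "\<And>\<theta>. \<theta> \<in> {0..tb} - N \<Longrightarrow> F \<theta> < c \<Longrightarrow> \<theta> \<in> A"
    and upper: "\<And>\<theta>. \<theta> \<in> A - N \<Longrightarrow> F \<theta> \<le> c"
  shows "measure M A = c"
proof (rule antisym)
  note q = measure_quantile[OF c] and N0 = null_sets_M[OF N]
  then have NM: "N \<in> sets borel" by auto
  have "measure M A \<le> measure M ({\<theta>\<in>{0..tb}. F \<theta> \<le> c} \<union> N)"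
  proof (rule M.finite_measure_mono)
    show "A \<subseteq> {\<theta>\<in>{0..tb}. F \<theta> \<le> c} \<union> N" using upper A(2) by blast
    show "{\<theta>\<in>{0..tb}. F \<theta> \<le> c} \<union> N \<in> sets M" using q(1) NM by simp
  qed
  then show "measure M A \<le> c" using q N0 by (simp add: measure_Un_null_set)
  have "measure M ({\<theta>\<in>{0..tb}. F \<theta> < c} - N) \<le> measure M A"
    by (rule M.finite_measure_mono) (use lower A(1) in auto)
  then show "c \<le> measure M A" using q N0 by (simp add: measure_Diff_null_set)
qed

text \<open>The mid-ranks of a pooling allocation reproduce themselves as statuses, so they can serve as
  the levels.\<close>

lemma status_pooling:
  assumes P: "pooling tb F I" and N: "countable N"
    and X: "\<And>\<theta>. \<theta> \<in> {0<..tb} - N \<Longrightarrow> X \<theta> \<omega> = (fst (I \<theta>) + snd (I \<theta>)) / 2"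
    and meas: "\<And>q. {\<theta>\<in>{0..tb}. X \<theta> \<omega> \<le> q} \<in> sets borel"
    and \<theta>0: "\<theta>0 \<in> {0<..tb} - N"
  shows "status tb f X \<omega> (X \<theta>0 \<omega>) = X \<theta>0 \<omega>"
proof (cases "X \<theta>0 \<omega> = 0")
  case True
  then show ?thesis by (simp add: status_def)
next
  case False
  obtain a b where ab: "I \<theta>0 = (a, b)" by fastforce
  have bracket: "bracket (F \<theta>) (I \<theta>)" if "\<theta> \<in> {0<..tb}" for \<theta>
    using P that by (simp add: pooling_def)
  have prec: "precedes (I \<theta>) (I \<theta>')" if "\<theta> \<in> {0<..tb}" "\<theta>' \<in> {0<..tb}" "\<theta> < \<theta>'" for \<theta> \<theta>'
    using P that by (simp add: pooling_def)
  define q where "q = X \<theta>0 \<omega>"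
  have q: "q = (a + b) / 2" using X[OF \<theta>0] ab by (simp add: q_def)
  \<comment> \<open>The encoding (-b, b) of exclusion would make the midpoint 0; in the present case
    the interval is thus a genuine pool with \<open>0 \<le> a\<close>.\<close>
  have b0: "a \<le> F \<theta>0" "F \<theta>0 \<le> b" "b \<le> 1" "0 \<le> a"
    using bracket[of \<theta>0] \<theta>0 False ab q by (auto simp: bracket_def q_def)
  define m where "m \<theta> = (fst (I \<theta>) + snd (I \<theta>)) / 2" for \<theta>
  have trichotomy: "\<theta> < \<theta>0 \<and> snd (I \<theta>) \<le> a \<or> I \<theta> = (a, b) \<or> \<theta>0 < \<theta> \<and> b \<le> fst (I \<theta>)"
    if "\<theta> \<in> {0<..tb}" for \<theta>
    using prec[of \<theta> \<theta>0] prec[of \<theta>0 \<theta>] that \<theta>0 ab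
    by (cases \<theta> \<theta>0 rule: linorder_cases) (auto simp: precedes_def)
  \<comment> \<open>These implications yield mass a strictly below \<open>q\<close> and mass b
    weakly below it. They are not equivalences: types of rank exactly a or b may lie in the pool of
    \<open>\<theta>0\<close> or in a neighbouring one.\<close>
  have facts: "(F \<theta> < a \<longrightarrow> m \<theta> < q) \<and> (m \<theta> < q \<longrightarrow> F \<theta> \<le> a) \<and>
      (m \<theta> \<le> q \<longrightarrow> F \<theta> \<le> b) \<and> (F \<theta> < b \<longrightarrow> m \<theta> \<le> q)" if "\<theta> \<in> {0<..tb}" for \<theta>
  proof -
    have J: "fst (I \<theta>) \<le> F \<theta>" "F \<theta> \<le> snd (I \<theta>)" using bracket[OF that] by (auto simp: bracket_def)
    have m: "2 * m \<theta> = fst (I \<theta>) + snd (I \<theta>)" "2 * q = a + b" by (simp_all add: m_def q)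
    note t = trichotomy[OF that]
    consider "\<theta> < \<theta>0" "snd (I \<theta>) \<le> a" | "fst (I \<theta>) = a" "snd (I \<theta>) = b" | "\<theta>0 < \<theta>" "b \<le> fst (I \<theta>)"
      using t by fastforce
    then show ?thesis using J m b0 by cases (intro conjI impI; linarith)+
  qed
  have XN: "X \<theta> \<omega> = m \<theta>" "\<theta> \<in> {0<..tb}" if "\<theta> \<in> {0..tb} - insert 0 N" for \<theta>
    using X[of \<theta>] that by (auto simp: m_def)
  have less: "{\<theta>\<in>{0..tb}. X \<theta> \<omega> < q} \<in> sets borel"
  proof -
    have "{\<theta>\<in>{0..tb}. X \<theta> \<omega> < q} = (\<Union>n::nat. {\<theta>\<in>{0..tb}. X \<theta> \<omega> \<le> q - 1 / Suc n})"
    proof (intro set_eqI iffI)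
      fix \<theta> assume *: "\<theta> \<in> {\<theta>\<in>{0..tb}. X \<theta> \<omega> < q}"
      then obtain n where "inverse (real (Suc n)) < q - X \<theta> \<omega>"
        using reals_Archimedean[of "q - X \<theta> \<omega>"] by auto
      with * show "\<theta> \<in> (\<Union>n::nat. {\<theta>\<in>{0..tb}. X \<theta> \<omega> \<le> q - 1 / Suc n})"
        by (auto simp: inverse_eq_divide intro!: exI[of _ n])
    next
      fix \<theta> assume "\<theta> \<in> (\<Union>n::nat. {\<theta>\<in>{0..tb}. X \<theta> \<omega> \<le> q - 1 / Suc n})"
      then obtain n where "\<theta> \<in> {0..tb}" "X \<theta> \<omega> \<le> q - 1 / Suc n" by blast
      moreover have "q - 1 / real (Suc n) < q" by simp
      ultimately show "\<theta> \<in> {\<theta>\<in>{0..tb}. X \<theta> \<omega> < q}" by (metis (mono_tags, lifting) le_less_trans mem_Collect_eq)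
    qed
    then show ?thesis using meas by (simp add: sets.countable_UN)
  qed
  have "measure M {\<theta>\<in>{0..tb}. X \<theta> \<omega> < q} = a"
  proof (rule measure_sandwich[where N = "insert 0 N"])
    show "a \<in> {0..1}" using b0 by simp
    show "\<theta> \<in> {\<theta>\<in>{0..tb}. X \<theta> \<omega> < q}" if "\<theta> \<in> {0..tb} - insert 0 N" "F \<theta> < a" for \<theta>
      using facts[OF XN(2)[OF that(1)]] XN(1)[OF that(1)] that by simp
    show "F \<theta> \<le> a" if "\<theta> \<in> {\<theta>\<in>{0..tb}. X \<theta> \<omega> < q} - insert 0 N" for \<theta>
    proof -
      have "\<theta> \<in> {0..tb} - insert 0 N" using that by auto
      from facts[OF XN(2)[OF this]] XN(1)[OF this] that show ?thesis by simp
    qed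
  qed (use less N in auto)
  moreover have "measure M {\<theta>\<in>{0..tb}. X \<theta> \<omega> \<le> q} = b"
  proof (rule measure_sandwich[where N = "insert 0 N"])
    show "b \<in> {0..1}" using b0 by simp
    show "\<theta> \<in> {\<theta>\<in>{0..tb}. X \<theta> \<omega> \<le> q}" if "\<theta> \<in> {0..tb} - insert 0 N" "F \<theta> < b" for \<theta>
      using facts[OF XN(2)[OF that(1)]] XN(1)[OF that(1)] that by simp
    show "F \<theta> \<le> b" if "\<theta> \<in> {\<theta>\<in>{0..tb}. X \<theta> \<omega> \<le> q} - insert 0 N" for \<theta>
    proof -
      have "\<theta> \<in> {0..tb} - insert 0 N" using that by auto
      from facts[OF XN(2)[OF this]] XN(1)[OF this] that show ?thesis by simp
    qed
  qed (use meas N in auto)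
  ultimately show ?thesis
    using False q status_eq[where X = X, OF meas] by (simp add: q_def)
qed

subsection \<open>Necessity\<close>

text \<open>Averaged over \<open>q\<close> in the population, this gives the mean of the strict and
  the weak distribution function at \<open>p\<close>, i.e. the status formula extended to level 0.
  The antisymmetry \<open>beats_swap\<close> is what makes comparisons cancel.\<close>

definition beats :: "real \<Rightarrow> real \<Rightarrow> real" where
  "beats p q = (if q < p then 1 else if q = p then 1 / 2 else 0)"

lemma beats_measurable [measurable]: "case_prod beats \<in> borel_measurable (borel \<Otimes>\<^sub>M borel)"
  unfolding beats_def by measurable

lemma beats_bounds: "0 \<le> beats p q" "beats p q \<le> 1"
  by (auto simp: beats_def)

lemma beats_swap: "beats p q + beats q p = 1"
  by (auto simp: beats_def)

lemma measure_UNIV_M: "measure M UNIV = 1"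
  using emeasure_M_space by (simp add: measure_def)

lemma types_AE: "AE \<theta> in M. \<theta> \<in> {0..tb}"
  unfolding M_def by (subst AE_density) (simp, auto simp: dens_def indicator_def)

lemma integrable_M_bounded:
  fixes g :: "real \<Rightarrow> real"
  assumes "g \<in> borel_measurable borel" "\<And>x. \<bar>g x\<bar> \<le> B"
  shows "integrable M g"
  by (rule M.integrable_const_bound[of _ B]) (use assms in \<open>auto simp: M_def\<close>)

lemma integral_beats:
  assumes [measurable]: "\<xi> \<in> borel_measurable borel"
  shows "(\<integral>\<theta>'. beats q (\<xi> \<theta>') \<partial>M) = (measure M {\<theta>\<in>{0..tb}. \<xi> \<theta> < q} + measure M {\<theta>\<in>{0..tb}. \<xi> \<theta> \<le> q}) / 2"
proof -
  define A where "A = {\<theta>\<in>{0..tb}. \<xi> \<theta> < q}"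
  define B where "B = {\<theta>\<in>{0..tb}. \<xi> \<theta> \<le> q}"
  have [measurable]: "A \<in> sets borel" "B \<in> sets borel" unfolding A_def B_def by measurable
  have "(\<integral>\<theta>'. beats q (\<xi> \<theta>') \<partial>M) = (\<integral>\<theta>. indicator A \<theta> / 2 + indicator B \<theta> / 2 \<partial>M)"
  proof (rule integral_cong_AE)
    show "AE \<theta> in M. beats q (\<xi> \<theta>) = indicator A \<theta> / 2 + indicator B \<theta> / 2"
      using types_AE by eventually_elim (auto simp: A_def B_def beats_def indicator_def)
    have "(\<lambda>\<theta>. beats q (\<xi> \<theta>)) \<in> borel_measurable borel"
      "(\<lambda>\<theta>. indicator A \<theta> / 2 + indicator B \<theta> / 2 :: real) \<in> borel_measurable borel"
      by measurable
    then show "(\<lambda>\<theta>. beats q (\<xi> \<theta>)) \<in> borel_measurable M"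
      "(\<lambda>\<theta>. indicator A \<theta> / 2 + indicator B \<theta> / 2 :: real) \<in> borel_measurable M"
      by (simp_all add: M_def)
  qed
  also have "\<dots> = measure M A / 2 + measure M B / 2"
    by (subst Bochner_Integration.integral_add) (auto simp: M.emeasure_finite less_top[symmetric])
  finally show ?thesis by (simp add: A_def B_def add_divide_distrib)
qed

lemma pair_M: "pair_sigma_finite M M" "finite_measure (M \<Otimes>\<^sub>M M)"
  by (intro pair_sigma_finite.intro M.sigma_finite_measure_axioms)
    (intro finite_measure_pair_measure M.finite_measure_axioms)

text \<open>Within \<open>A\<close> the comparisons cancel pairwise to \<open>p\<^sup>2/2\<close>; against the rest of the population
  each type in \<open>A\<close> wins at most everything.\<close>

lemma total_rank_le:
  assumes \<xi> [measurable]: "\<xi> \<in> borel_measurable borel" and A [measurable]: "A \<in> sets borel"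
  shows "(\<integral>\<theta>. indicator A \<theta> * (\<integral>\<theta>'. beats (\<xi> \<theta>) (\<xi> \<theta>') \<partial>M) \<partial>M) \<le> measure M A - measure M A ^ 2 / 2"
proof -
  interpret P: pair_sigma_finite M M by (rule pair_M)
  interpret MM: finite_measure "M \<Otimes>\<^sub>M M" by (rule pair_M)
  define p where "p = measure M A"
  define ind :: "real \<Rightarrow> real" where "ind = indicator A"
  have [measurable]: "ind \<in> borel_measurable borel" by (simp add: ind_def)
  have ind: "0 \<le> ind x" "ind x \<le> 1" for x by (auto simp: ind_def indicator_def)
  have int_ind: "integral\<^sup>L M ind = p" by (simp add: ind_def p_def)
  define B where "B = (\<integral>\<theta>. \<integral>\<theta>'. ind \<theta> * ind \<theta>' * beats (\<xi> \<theta>) (\<xi> \<theta>') \<partial>M \<partial>M)"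
  have k_int: "integrable (M \<Otimes>\<^sub>M M) (\<lambda>(\<theta>, \<theta>'). ind \<theta> * ind \<theta>' * beats (\<xi> \<theta>) (\<xi> \<theta>'))"
    "integrable (M \<Otimes>\<^sub>M M) (\<lambda>(\<theta>, \<theta>'). ind \<theta> * ind \<theta>' * beats (\<xi> \<theta>') (\<xi> \<theta>))"
    by (rule MM.integrable_const_bound[of _ 1];
        auto simp: ind beats_bounds abs_mult split_beta intro!: mult_le_one mult_nonneg_nonneg)+
  \<comment> \<open>Exchanging the two integrations shows that \<open>B\<close> equally counts the
    reversed comparisons; added together, the two scores are 1 for every pair in
    \<open>A\<close>.\<close>
  have "B = (\<integral>\<theta>. \<integral>\<theta>'. ind \<theta> * ind \<theta>' * beats (\<xi> \<theta>') (\<xi> \<theta>) \<partial>M \<partial>M)"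
    unfolding B_def using P.Fubini_integral[OF k_int(2)] by (simp add: mult.commute)
  then have "B + B = integral\<^sup>L (M \<Otimes>\<^sub>M M) (\<lambda>(\<theta>, \<theta>'). ind \<theta> * ind \<theta>' * beats (\<xi> \<theta>) (\<xi> \<theta>'))
      + integral\<^sup>L (M \<Otimes>\<^sub>M M) (\<lambda>(\<theta>, \<theta>'). ind \<theta> * ind \<theta>' * beats (\<xi> \<theta>') (\<xi> \<theta>))"
    using P.integral_fst[OF k_int(1)] P.integral_fst[OF k_int(2)] by (simp add: B_def)
  also have "\<dots> = integral\<^sup>L (M \<Otimes>\<^sub>M M) (\<lambda>(\<theta>, \<theta>'). ind \<theta> * ind \<theta>')"
    by (subst Bochner_Integration.integral_add[symmetric, OF k_int])
      (intro Bochner_Integration.integral_cong refl,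
        auto simp: distrib_left[symmetric] beats_swap)
  also have "\<dots> = (\<integral>\<theta>. \<integral>\<theta>'. ind \<theta> * ind \<theta>' \<partial>M \<partial>M)"
    by (rule P.integral_fst[symmetric], rule MM.integrable_const_bound[of _ 1])
      (auto simp: ind abs_mult split_beta intro!: mult_le_one)
  also have "\<dots> = p ^ 2" by (simp add: int_ind power2_eq_square)
  finally have B: "B = p ^ 2 / 2" by simp
  have r: "integrable M (\<lambda>\<theta>'. beats (\<xi> \<theta>) (\<xi> \<theta>'))" "integrable M (\<lambda>\<theta>'. ind \<theta>' * beats (\<xi> \<theta>) (\<xi> \<theta>'))"
    "integrable M ind" for \<theta>
    by (rule integrable_M_bounded[of _ 1];
        auto simp: ind beats_bounds abs_mult intro!: mult_le_one)+
  have "(\<integral>\<theta>. ind \<theta> * (\<integral>\<theta>'. beats (\<xi> \<theta>) (\<xi> \<theta>') \<partial>M) \<partial>M)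
      \<le> (\<integral>\<theta>. ind \<theta> * (1 - p) + ind \<theta> * (\<integral>\<theta>'. ind \<theta>' * beats (\<xi> \<theta>) (\<xi> \<theta>') \<partial>M) \<partial>M)"
  proof (rule integral_mono)
    have b: "0 \<le> (\<integral>\<theta>'. g \<theta>' \<partial>M)" "(\<integral>\<theta>'. g \<theta>' \<partial>M) \<le> 1"
      if "integrable M g" "\<And>\<theta>'. 0 \<le> g \<theta>'" "\<And>\<theta>'. g \<theta>' \<le> 1" for g :: "real \<Rightarrow> real"
      using that integral_mono[OF that(1), of "\<lambda>_. 1"] measure_UNIV_M by auto
    have b1: "0 \<le> (\<integral>\<theta>'. beats (\<xi> \<theta>) (\<xi> \<theta>') \<partial>M)" "(\<integral>\<theta>'. beats (\<xi> \<theta>) (\<xi> \<theta>') \<partial>M) \<le> 1"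
      "0 \<le> (\<integral>\<theta>'. ind \<theta>' * beats (\<xi> \<theta>) (\<xi> \<theta>') \<partial>M)" "(\<integral>\<theta>'. ind \<theta>' * beats (\<xi> \<theta>) (\<xi> \<theta>') \<partial>M) \<le> 1" for \<theta>
      using b[OF r(1)] b[OF r(2) _ mult_le_one[OF ind(2) beats_bounds]] ind beats_bounds by simp_all
    show "integrable M (\<lambda>\<theta>. ind \<theta> * (\<integral>\<theta>'. beats (\<xi> \<theta>) (\<xi> \<theta>') \<partial>M))"
      using b1 by (intro integrable_M_bounded[of _ 1]) (auto simp: ind abs_mult intro!: mult_le_one)
    have "integrable M (\<lambda>\<theta>. ind \<theta> * (\<integral>\<theta>'. ind \<theta>' * beats (\<xi> \<theta>) (\<xi> \<theta>') \<partial>M))"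
      using b1 by (intro integrable_M_bounded[of _ 1]) (auto simp: ind abs_mult intro!: mult_le_one)
    then show "integrable M (\<lambda>\<theta>. ind \<theta> * (1 - p) + ind \<theta> * (\<integral>\<theta>'. ind \<theta>' * beats (\<xi> \<theta>) (\<xi> \<theta>') \<partial>M))"
      using r(3) by simp
    show "ind \<theta> * (\<integral>\<theta>'. beats (\<xi> \<theta>) (\<xi> \<theta>') \<partial>M) \<le>
        ind \<theta> * (1 - p) + ind \<theta> * (\<integral>\<theta>'. ind \<theta>' * beats (\<xi> \<theta>) (\<xi> \<theta>') \<partial>M)" for \<theta>
    proof -
      have "(\<integral>\<theta>'. beats (\<xi> \<theta>) (\<xi> \<theta>') \<partial>M) \<le> (\<integral>\<theta>'. (1 - ind \<theta>') + ind \<theta>' * beats (\<xi> \<theta>) (\<xi> \<theta>') \<partial>M)"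
      proof (rule integral_mono)
        show "integrable M (\<lambda>\<theta>'. (1 - ind \<theta>') + ind \<theta>' * beats (\<xi> \<theta>) (\<xi> \<theta>'))"
          using r by (intro Bochner_Integration.integrable_add Bochner_Integration.integrable_diff) auto
      qed (use r in \<open>auto simp: ind_def indicator_def beats_bounds\<close>)
      also have "\<dots> = (1 - p) + (\<integral>\<theta>'. ind \<theta>' * beats (\<xi> \<theta>) (\<xi> \<theta>') \<partial>M)"
        using r int_ind measure_UNIV_M by simp
      finally show ?thesis
        using mult_left_mono[OF _ ind(1)[of \<theta>]] by (simp add: distrib_left[symmetric])
    qed
  qed
  also have "\<dots> = p * (1 - p) + B"
  proof -
    have "integrable M (\<lambda>\<theta>. \<integral>\<theta>'. ind \<theta> * ind \<theta>' * beats (\<xi> \<theta>) (\<xi> \<theta>') \<partial>M)"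
      using P.integrable_fst[OF k_int(1)] by simp
    then show ?thesis using r(3) int_ind by (simp add: B_def mult.assoc)
  qed
  finally show ?thesis
    using B by (simp add: p_def ind_def algebra_simps power2_eq_square)
qed

text \<open>Exclusion replaces a nonnegative rank by 0, so the status is at most the rank and
  \<open>total_rank_le\<close> applies in each state. With \<open>p = 1 - F x\<close> its bound p -
  p^2 / 2 equals (1 - F(x)^2) / 2, the integral of \<open>F\<close> over the same types; Fubini then
  averages over states.\<close>

lemma feasible_imp_majorized:
  assumes "feasible tb f s" and x: "x \<in> {0..tb}"
  shows "(LINT \<theta>:{x..tb}|lborel. s \<theta> * f \<theta>) \<le> (LINT \<theta>:{x..tb}|lborel. F \<theta> * f \<theta>)"
proof -
  obtain X where X: "allocation tb X"
    and s: "\<And>\<theta>. \<theta> \<in> {0..tb} \<Longrightarrow> s \<theta> = interim_status tb f X \<theta>"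
    using assms(1) unfolding feasible_def by blast
  \<comment> \<open>Extension by zero turns measurability on the rectangle into Borel measurability
    on the plane, as Fubini requires.\<close>
  define Y where "Y p = indicator ({0..tb} \<times> {0..1}) p *\<^sub>R X (fst p) (snd p)" for p :: "real \<times> real"
  have "{0..tb} \<times> {0..1::real} \<in> sets borel" by (intro borel_closed closed_Times) auto
  then have "Y \<in> borel_measurable borel"
    using X unfolding Y_def allocation_def
    by (subst borel_measurable_restrict_space_iff[symmetric]) auto
  then have Y [measurable]: "Y \<in> borel_measurable (borel \<Otimes>\<^sub>M borel)" by (simp add: borel_prod)
  define S where "S \<theta> \<omega> = (if Y (\<theta>, \<omega>) = 0 then 0 else \<integral>\<theta>'. beats (Y (\<theta>, \<omega>)) (Y (\<theta>', \<omega>)) \<partial>M)" for \<theta> \<omega>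
  have "(\<lambda>p. \<integral>\<theta>'. beats (Y p) (Y (\<theta>', snd p)) \<partial>M) \<in> borel_measurable (borel \<Otimes>\<^sub>M borel)"
    by measurable
  then have S_meas [measurable]: "case_prod S \<in> borel_measurable (borel \<Otimes>\<^sub>M borel)"
    unfolding S_def split_beta' by measurable
  have sect: "(\<lambda>\<theta>. Y (\<theta>, \<omega>)) \<in> borel_measurable borel" for \<omega> by measurable
  have S_bounds: "0 \<le> S \<theta> \<omega>" "S \<theta> \<omega> \<le> (\<integral>\<theta>'. beats (Y (\<theta>, \<omega>)) (Y (\<theta>', \<omega>)) \<partial>M)" "S \<theta> \<omega> \<le> 1" for \<theta> \<omega>
  proof -
    have i: "integrable M (\<lambda>\<theta>'. beats (Y (\<theta>, \<omega>)) (Y (\<theta>', \<omega>)))"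
      by (rule integrable_M_bounded[of _ 1]) (auto simp: beats_bounds)
    then have "0 \<le> (\<integral>\<theta>'. beats (Y (\<theta>, \<omega>)) (Y (\<theta>', \<omega>)) \<partial>M)"
      "(\<integral>\<theta>'. beats (Y (\<theta>, \<omega>)) (Y (\<theta>', \<omega>)) \<partial>M) \<le> 1"
      using integral_mono[OF i, of "\<lambda>_. 1"] measure_UNIV_M by (auto simp: beats_bounds)
    then show "0 \<le> S \<theta> \<omega>" "S \<theta> \<omega> \<le> (\<integral>\<theta>'. beats (Y (\<theta>, \<omega>)) (Y (\<theta>', \<omega>)) \<partial>M)" "S \<theta> \<omega> \<le> 1"
      by (auto simp: S_def)
  qed
  have status: "status tb f X \<omega> (X \<theta> \<omega>) = S \<theta> \<omega>" if "\<theta> \<in> {0..tb}" "\<omega> \<in> {0..1}" for \<theta> \<omega>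
  proof -
    have XY: "X \<theta> \<omega> = Y (\<theta>, \<omega>)" if "\<theta> \<in> {0..tb}" for \<theta>
      using that \<open>\<omega> \<in> {0..1}\<close> by (simp add: Y_def)
    have "{\<theta>\<in>{0..tb}. X \<theta> \<omega> \<le> q} = {\<theta>\<in>{0..tb}. Y (\<theta>, \<omega>) \<le> q}" "{\<theta>\<in>{0..tb}. X \<theta> \<omega> < q} = {\<theta>\<in>{0..tb}. Y (\<theta>, \<omega>) < q}" for q
      using XY by auto
    then show ?thesis
      using status_eq[of X \<omega> "X \<theta> \<omega>"] integral_beats[OF sect, of "Y (\<theta>, \<omega>)" \<omega>] XY[OF that(1)] sect
      by (simp add: S_def)
  qed
  define W where "W = density lborel (\<lambda>\<omega>. ennreal (indicator {0..1::real} \<omega>))"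
  have sets_W [measurable_cong, simp]: "sets W = sets borel" by (simp add: W_def)
  have space_W [simp]: "space W = UNIV" by (simp add: W_def)
  have "emeasure W UNIV = 1"
    by (simp add: W_def emeasure_density ennreal_indicator)
  then interpret W: finite_measure W by (intro finite_measureI) simp
  have W1: "measure W UNIV = 1" using \<open>emeasure W UNIV = 1\<close> by (simp add: measure_def)
  have W_int: "(LINT \<omega>:{0..1}|lborel. g \<omega>) = (\<integral>\<omega>. g \<omega> \<partial>W)" if "g \<in> borel_measurable borel" for g :: "real \<Rightarrow> real"
    unfolding W_def set_lebesgue_integral_def using that by (subst integral_real_density) auto
  interpret P: pair_sigma_finite M W
    by (intro pair_sigma_finite.intro M.sigma_finite_measure_axioms W.sigma_finite_measure_axioms)
  interpret PW: finite_measure "M \<Otimes>\<^sub>M W"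
    by (intro finite_measure_pair_measure M.finite_measure_axioms W.finite_measure_axioms)
  define A where "A = {x..tb}"
  have A: "A \<in> sets borel" "A \<subseteq> {0..tb}" using x by (auto simp: A_def)
  have s_eq: "s \<theta> = (\<integral>\<omega>. S \<theta> \<omega> \<partial>W)" if "\<theta> \<in> {0..tb}" for \<theta>
  proof -
    have "s \<theta> = (LINT \<omega>:{0..1}|lborel. S \<theta> \<omega>)"
      unfolding s[OF that] interim_status_def
      by (rule set_lebesgue_integral_cong) (use status that in auto)
    then show ?thesis by (simp add: W_int)
  qed
  have "(LINT \<theta>:A|lborel. s \<theta> * f \<theta>) = (LINT \<theta>:A|lborel. (\<integral>\<omega>. S \<theta> \<omega> \<partial>W) * f \<theta>)"
    by (rule set_lebesgue_integral_cong) (use A s_eq in auto)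
  also have "\<dots> = (\<integral>\<theta>. indicator A \<theta> * (\<integral>\<omega>. S \<theta> \<omega> \<partial>W) \<partial>M)"
    using A by (subst set_integral_M) (auto simp: set_lebesgue_integral_def)
  also have "\<dots> = (\<integral>\<theta>. (\<integral>\<omega>. indicator A \<theta> * S \<theta> \<omega> \<partial>W) \<partial>M)" by simp
  also have "\<dots> = (\<integral>\<omega>. (\<integral>\<theta>. indicator A \<theta> * S \<theta> \<omega> \<partial>M) \<partial>W)"
    by (rule P.Fubini_integral[symmetric], rule PW.integrable_const_bound[of _ 1])
      (use A S_bounds in \<open>auto simp: split_beta abs_mult indicator_def\<close>)
  also have "\<dots> \<le> (\<integral>\<omega>. measure M A - measure M A ^ 2 / 2 \<partial>W)"
  proof (rule integral_mono)
    have i1: "integrable M (\<lambda>\<theta>. indicator A \<theta> * S \<theta> \<omega>)" for \<omega>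
      by (rule integrable_M_bounded[of _ 1]) (use A S_bounds in \<open>auto simp: abs_mult indicator_def\<close>)
    have i2: "integrable M (\<lambda>\<theta>. indicator A \<theta> * (\<integral>\<theta>'. beats (Y (\<theta>, \<omega>)) (Y (\<theta>', \<omega>)) \<partial>M))" for \<omega>
    proof -
      have i: "integrable M (\<lambda>\<theta>'. beats (Y (\<theta>, \<omega>)) (Y (\<theta>', \<omega>)))" for \<theta>
        by (rule integrable_M_bounded[of _ 1]) (auto simp: beats_bounds)
      have "0 \<le> (\<integral>\<theta>'. beats (Y (\<theta>, \<omega>)) (Y (\<theta>', \<omega>)) \<partial>M)"
        "(\<integral>\<theta>'. beats (Y (\<theta>, \<omega>)) (Y (\<theta>', \<omega>)) \<partial>M) \<le> 1" for \<theta>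
        using integral_mono[OF i, of "\<lambda>_. 1" \<theta>] measure_UNIV_M by (auto simp: beats_bounds)
      then show ?thesis
        using A by (intro integrable_M_bounded[of _ 1]) (auto simp: abs_mult indicator_def)
    qed
    show "(\<integral>\<theta>. indicator A \<theta> * S \<theta> \<omega> \<partial>M) \<le> measure M A - measure M A ^ 2 / 2" for \<omega>
      using integral_mono[OF i1 i2, of \<omega>] S_bounds(2) total_rank_le[OF sect A(1), of \<omega>]
      by (force intro: mult_left_mono)
    have "0 \<le> (\<integral>\<theta>. indicator A \<theta> * S \<theta> \<omega> \<partial>M)" "(\<integral>\<theta>. indicator A \<theta> * S \<theta> \<omega> \<partial>M) \<le> 1" for \<omega>
      using integral_mono[OF i1, of "\<lambda>_. 1" \<omega>] measure_UNIV_M S_bounds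
      by (auto simp: indicator_def)
    then show "integrable W (\<lambda>\<omega>. \<integral>\<theta>. indicator A \<theta> * S \<theta> \<omega> \<partial>M)"
      using A by (intro W.integrable_const_bound[of _ 1]) auto
  qed simp
  also have "\<dots> = measure M A - measure M A ^ 2 / 2" using W1 by simp
  also have "measure M A = 1 - F x"
  proof -
    \<comment> \<open>\<open>F\<close> measures initial segments, so the final segment is a
      complement, up to the null point \<open>x\<close>.\<close>
    have "A = ({0..tb} - {0..x}) \<union> {x}" using x by (auto simp: A_def)
    moreover have "measure M (({0..tb} - {0..x}) \<union> {x}) = measure M ({0..tb} - {0..x})"
      by (rule measure_Un_null_set) (auto simp: null_sets_M)
    ultimately have "measure M A = measure M ({0..tb} - {0..x})" by simp
    then show ?thesis using measure_M_Diff[of "{0..x}"] measure_M_le_F[OF x] x by simp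
  qed
  also have "(1 - F x) - (1 - F x) ^ 2 / 2 = (1 - F x ^ 2) / 2"
    by (simp add: power2_eq_square field_simps)
  finally show ?thesis using integral_F_f[OF x] by (simp add: A_def)
qed

subsection \<open>Sufficiency\<close>

lemma measure_M_Ico:
  assumes "x \<in> {0..tb}" "y \<in> {0..tb}" "x \<le> y"
  shows "measure M {x..<y} = F y - F x"
proof -
  have "{0..y} - {0..x} = {x<..y}" using assms by auto
  then have "measure M {x<..y} = F y - F x"
    using M.finite_measure_Diff[of "{0..y}" "{0..x}"] measure_M_le_F assms by simp
  moreover have "measure M {x..<y} = measure M (({x<..y} - {y}) \<union> ({x} - {y}))"
    using assms by (intro arg_cong[where f = "measure M"]) auto
  moreover have "{x} - {y} \<in> null_sets M" by (intro null_sets_M) auto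
  ultimately show ?thesis
    using null_sets_M[of "{y}"] by (simp add: measure_Un_null_set measure_Diff_null_set)
qed

definition quantile :: "real \<Rightarrow> real" where
  "quantile p = (SOME \<theta>. \<theta> \<in> {0..tb} \<and> F \<theta> = p)"

lemma quantile:
  assumes "p \<in> {0..1}"
  shows "quantile p \<in> {0..tb} \<and> F (quantile p) = p"
  unfolding quantile_def by (rule someI_ex) (use F_surj[OF assms] in blast)

lemma quantile_le: "p \<in> {0..1} \<Longrightarrow> p' \<in> {0..1} \<Longrightarrow> p \<le> p' \<Longrightarrow> quantile p \<le> quantile p'"
  using F_le[of "quantile p" "quantile p'"] quantile by auto

text \<open>Each cell between consecutive points \<open>z i\<close> has mass 1 / n and
  \<open>s\<close> is least at its left end, so the sum divided by n is a lower sum for the integral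
  of \<open>s\<close> from \<open>z r\<close> upwards. Majorization bounds that integral by (1 - (r
  / n)^2) / 2, and the factor 2n^2 clears denominators.\<close>

lemma majorized_sums:
  assumes s: "mono_on {0..tb} s" "\<And>\<theta>. \<theta> \<in> {0..tb} \<Longrightarrow> 0 \<le> s \<theta>"
    and maj: "\<And>x. x \<in> {0..tb} \<Longrightarrow>
      (LINT \<theta>:{x..tb}|lborel. s \<theta> * f \<theta>) \<le> (LINT \<theta>:{x..tb}|lborel. F \<theta> * f \<theta>)"
    and r: "r \<le> n"
  shows "2 * real n * (\<Sum>i\<in>{r..<n}. s (quantile (real i / real n))) \<le> real n ^ 2 - real r ^ 2"
proof (cases "n = 0")
  case False
  define z where "z i = quantile (real i / real n)" for i
  have frac: "real i / real n \<in> {0..1}" if "i \<le> n" for i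
    using that False by (auto simp: divide_le_eq)
  have z: "z i \<in> {0..tb}" "F (z i) = real i / real n" if "i \<le> n" for i
    using quantile[OF frac[OF that]] by (auto simp: z_def)
  have z_le: "z i \<le> z (Suc i)" if "Suc i \<le> n" for i
    unfolding z_def using that False by (intro quantile_le frac divide_right_mono) auto
  have "F (z n) = F tb" using z[of n] F_ends False by simp
  then have z_n: "z n = tb" using F_le[of "z n" tb] F_le[of tb "z n"] z[of n] by auto
  \<comment> \<open>Constant continuation beyond {0..tb} gives a function monotone on the whole
    line, hence Borel.\<close>
  define t where "t \<theta> = s (max 0 (min tb \<theta>))" for \<theta>
  have "mono t" unfolding t_def
    using tb_pos by (intro monoI mono_onD[OF s(1)]) auto
  then have [measurable]: "t \<in> borel_measurable borel" by (rule borel_measurable_mono)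
  have t: "t \<theta> = s \<theta>" if "\<theta> \<in> {0..tb}" for \<theta> using that by (simp add: t_def)
  have int: "set_integrable M A t" if [measurable]: "A \<in> sets borel" for A
    unfolding set_integrable_def
  proof (rule M.integrable_const_bound[of _ "s tb"])
    have "0 \<le> t x \<and> t x \<le> s tb" for x
      unfolding t_def using tb_pos s by (auto intro!: s(2) mono_onD[OF s(1)])
    then show "AE x in M. norm (indicator A x *\<^sub>R t x) \<le> s tb"
      by (auto simp: indicator_def intro: order_trans)
    have "(\<lambda>x. indicator A x *\<^sub>R t x) \<in> borel_measurable borel" by measurable
    then show "(\<lambda>x. indicator A x *\<^sub>R t x) \<in> borel_measurable M" by (simp add: M_def)
  qed
  have sum_le: "(\<Sum>i\<in>{r..<n}. s (z i)) / n \<le> (LINT \<theta>:{z r..tb}|M. t \<theta>)" if "r \<le> n" for r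
    using that
  proof (induction r rule: inc_induct)
    case base
    have "0 \<le> (LINT \<theta>:{z n..tb}|M. t \<theta>)"
      unfolding set_lebesgue_integral_def
      using s tb_pos by (intro Bochner_Integration.integral_nonneg) (auto simp: t_def)
    then show ?case by simp
  next
    case (step r)
    have le: "z r \<le> z (Suc r)" "z (Suc r) \<le> tb" "0 \<le> z r" "z r \<le> tb"
      using z_le[of r] z[of "Suc r"] z[of r] step by auto
    have "{z r..tb} = {z r..<z (Suc r)} \<union> {z (Suc r)..tb}" using le by auto
    then have "(LINT \<theta>:{z r..tb}|M. t \<theta>) = (LINT \<theta>:{z r..<z (Suc r)}|M. t \<theta>) + (LINT \<theta>:{z (Suc r)..tb}|M. t \<theta>)"
      using int by (simp only:) (intro set_integral_Un; auto)
    moreover have "s (z r) / n \<le> (LINT \<theta>:{z r..<z (Suc r)}|M. t \<theta>)"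
    proof -
      have "measure M {z r..<z (Suc r)} = 1 / n"
        using measure_M_Ico[of "z r" "z (Suc r)"] z[of r] z[of "Suc r"] le step False
        by (simp add: diff_divide_distrib[symmetric])
      then have "s (z r) / n = (LINT \<theta>:{z r..<z (Suc r)}|M. s (z r))"
        by (simp add: set_lebesgue_integral_def)
      also have "\<dots> \<le> (LINT \<theta>:{z r..<z (Suc r)}|M. t \<theta>)"
      proof (rule set_integral_mono)
        show "set_integrable M {z r..<z (Suc r)} (\<lambda>_. s (z r))"
          by (simp add: set_integrable_def M.emeasure_finite less_top[symmetric])
        show "s (z r) \<le> t \<theta>" if "\<theta> \<in> {z r..<z (Suc r)}" for \<theta>
          using that le t[of \<theta>] by (auto intro!: mono_onD[OF s(1)])
      qed (use int in auto)
      finally show ?thesis .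
    qed
    moreover have "(\<Sum>i\<in>{r..<n}. s (z i)) = s (z r) + (\<Sum>i\<in>{Suc r..<n}. s (z i))"
      using step by (simp add: sum.atLeast_Suc_lessThan)
    ultimately show ?case using step.IH by (simp add: add_divide_distrib)
  qed
  have "(LINT \<theta>:{z r..tb}|M. t \<theta>) = (LINT \<theta>:{z r..tb}|lborel. t \<theta> * f \<theta>)"
    using z[OF r] by (intro set_integral_M[symmetric]) auto
  also have "\<dots> = (LINT \<theta>:{z r..tb}|lborel. s \<theta> * f \<theta>)"
    using z[OF r] t by (intro set_lebesgue_integral_cong) auto
  also have "\<dots> \<le> (1 - (real r / real n) ^ 2) / 2"
    using maj[OF z(1)[OF r]] integral_F_f[OF z(1)[OF r]] z(2)[OF r] by simp
  finally have "(\<Sum>i\<in>{r..<n}. s (z i)) / n \<le> (1 - (real r / real n) ^ 2) / 2"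
    using sum_le[OF r] by linarith
  then have "2 * real n ^ 2 * ((\<Sum>i\<in>{r..<n}. s (z i)) / n) \<le> 2 * real n ^ 2 * ((1 - (real r / real n) ^ 2) / 2)"
    by (rule mult_left_mono) simp
  moreover have "2 * real n ^ 2 * ((\<Sum>i\<in>{r..<n}. s (z i)) / n) = 2 * real n * (\<Sum>i\<in>{r..<n}. s (z i))"
    using False by (simp add: power2_eq_square)
  moreover have "2 * real n ^ 2 * ((1 - (real r / real n) ^ 2) / 2) = real n ^ 2 - real r ^ 2"
    using False by (simp add: power_divide right_diff_distrib)
  ultimately show ?thesis by (simp only: z_def)
qed (use r in simp)

lemma majorized_imp_feasible:
  assumes range: "\<And>\<theta>. \<theta> \<in> {0..tb} \<Longrightarrow> s \<theta> \<in> {0..1}" and mono: "mono_on {0..tb} s"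
    and maj: "\<And>x. x \<in> {0..tb} \<Longrightarrow>
      (LINT \<theta>:{x..tb}|lborel. s \<theta> * f \<theta>) \<le> (LINT \<theta>:{x..tb}|lborel. F \<theta> * f \<theta>)"
  shows "feasible tb f s"
proof -
  have "0 \<le> s 0" using range[of 0] tb_pos by simp
  moreover have "2 * real n * (\<Sum>i\<in>{r..<n}. s (quantile (real i / real n))) \<le> real n ^ 2 - real r ^ 2"
    if "r \<le> n" for n r
    by (rule majorized_sums[OF mono _ maj that]) (use range in auto)
  ultimately obtain I0 :: "real \<Rightarrow> real \<Rightarrow> real \<times> real" and J where I0: "\<And>\<omega>. \<omega> \<in> {0..1} \<Longrightarrow> pooling tb F (\<lambda>\<theta>. I0 \<theta> \<omega>)"
    "\<And>\<theta>. \<theta> \<in> {0<..tb} \<Longrightarrow> mono_on {0..1} (\<lambda>\<omega>. - fst (I0 \<theta> \<omega>))"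
    "\<And>\<theta>. \<theta> \<in> {0<..tb} \<Longrightarrow> mono_on {0..1} (\<lambda>\<omega>. snd (I0 \<theta> \<omega>))"
    "\<And>\<theta>. \<theta> \<in> {0<..tb} \<Longrightarrow> ((\<lambda>\<omega>. fst (I0 \<theta> \<omega>) + snd (I0 \<theta> \<omega>)) has_integral 2 * J \<theta>) {0..1}"
    "\<And>\<theta>. \<theta> \<in> {0<..tb} \<Longrightarrow> J \<theta> \<le> s \<theta>"
    "\<And>\<theta> \<theta>'. 0 \<le> \<theta>' \<Longrightarrow> \<theta>' < \<theta> \<Longrightarrow> \<theta> \<le> tb \<Longrightarrow> s \<theta>' \<le> J \<theta>"
    using limit_pooling[OF F_strict_mono F_ends tb_pos quantile mono] by blast
  \<comment> \<open>Makes the end points monotone in \<omega> on the whole line, so that they are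
    Borel for each fixed type.\<close>
  define clamp where "clamp \<omega> = max 0 (min 1 \<omega>)" for \<omega> :: real
  have clamp: "clamp \<omega> \<in> {0..1}" "\<omega> \<in> {0..1} \<Longrightarrow> clamp \<omega> = \<omega>" for \<omega>
    by (auto simp: clamp_def)
  define I where "I \<theta> \<omega> = (if \<theta> \<in> {0<..tb} then I0 \<theta> (clamp \<omega>) else (0, 0))" for \<theta> \<omega>
  have P: "pooling tb F (\<lambda>\<theta>. I \<theta> \<omega>)" for \<omega>
    using I0(1)[OF clamp(1)[of \<omega>]] by (simp add: pooling_def I_def)
  have I_meas [measurable]: "I \<theta> \<in> borel_measurable borel" for \<theta>
  proof (cases "\<theta> \<in> {0<..tb}")
    case True
    have "mono (\<lambda>\<omega>. - fst (I0 \<theta> (clamp \<omega>)))" "mono (\<lambda>\<omega>. snd (I0 \<theta> (clamp \<omega>)))"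
      using I0(2,3)[OF True] clamp(1) by (auto simp: mono_def mono_on_def clamp_def)
    then have a: "(\<lambda>\<omega>. - fst (I0 \<theta> (clamp \<omega>))) \<in> borel_measurable borel"
      and b: "(\<lambda>\<omega>. snd (I0 \<theta> (clamp \<omega>))) \<in> borel_measurable borel"
      by (blast intro: borel_measurable_mono)+
    from borel_measurable_uminus[OF a] b
    have "(\<lambda>\<omega>. (fst (I0 \<theta> (clamp \<omega>)), snd (I0 \<theta> (clamp \<omega>)))) \<in> borel_measurable borel"
      by (intro borel_measurable_Pair) simp_all
    moreover have "I \<theta> = (\<lambda>\<omega>. (fst (I0 \<theta> (clamp \<omega>)), snd (I0 \<theta> (clamp \<omega>))))"
      using True by (simp add: I_def fun_eq_iff)
    ultimately show ?thesis by simp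
  next
    case False
    then have "I \<theta> = (\<lambda>_. (0, 0))" by (auto simp: I_def)
    then show ?thesis by simp
  qed
  define L where "L \<theta> \<omega> = left_limit (\<lambda>\<theta>. I \<theta> \<omega>) \<theta>" for \<theta> \<omega>
  have L_pool: "pooling tb F (\<lambda>\<theta>. L \<theta> \<omega>)" for \<omega>
    unfolding L_def by (rule pooling_left_limit[OF P F_continuous])
  have L_lim: "(\<lambda>k. I (dyadic_below k \<theta>) \<omega>) \<longlonglongrightarrow> L \<theta> \<omega>" if "\<theta> \<in> {0<..tb}" for \<theta> \<omega>
    unfolding L_def by (rule left_limit_tendsto[OF P that])
  have L_meas [measurable]: "case_prod L \<in> borel_measurable (borel \<Otimes>\<^sub>M borel)"
  proof -
    have "(\<lambda>x. I ((real_of_int z - 1) / 2 ^ k) (snd x)) \<in> borel_measurable (borel \<Otimes>\<^sub>M borel)" for z :: int and k :: nat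
      by measurable
    moreover have "(\<lambda>x :: real \<times> real. \<lceil>2 ^ k * fst x\<rceil>) \<in> measurable (borel \<Otimes>\<^sub>M borel) (count_space UNIV)" for k :: nat
      by measurable
    ultimately have "(\<lambda>x. I ((real_of_int \<lceil>(2::real) ^ k * fst x\<rceil> - 1) / 2 ^ k) (snd x)) \<in> borel_measurable (borel \<Otimes>\<^sub>M borel)" for k :: nat
      by (rule measurable_compose_countable[where f = "\<lambda>z x. I ((real_of_int z - 1) / 2 ^ k) (snd x)"])
    then show ?thesis
      unfolding L_def left_limit_def dyadic_below_def split_beta'
      by (rule borel_measurable_lim_metric)
  qed
  define m where "m \<theta> \<omega> = (fst (L \<theta> \<omega>) + snd (L \<theta> \<omega>)) / 2" for \<theta> \<omega>
  have mid_meas: "(\<lambda>I. (fst I + snd I) / 2) \<in> borel_measurable (borel :: (real \<times> real) measure)"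
    by (intro borel_measurable_continuous_onI continuous_intros) simp
  have m_meas [measurable]: "case_prod m \<in> borel_measurable (borel \<Otimes>\<^sub>M borel)"
    using measurable_compose[OF L_meas mid_meas] by (simp add: m_def split_beta')
  have m_bounds: "m \<theta> \<omega> \<in> {0..1}" if "\<theta> \<in> {0<..tb}" for \<theta> \<omega>
  proof -
    have "bracket (F \<theta>) (L \<theta> \<omega>)" using L_pool[of \<omega>] that by (simp add: pooling_def)
    then show ?thesis using F_bounds[of \<theta>] that by (auto simp: bracket_def m_def)
  qed
  \<comment> \<open>The types at which the pooling construction need not induce \<open>s\<close>:
    the jumps of \<open>s\<close>, together with type 0, about which \<open>pooling\<close> says
    nothing.\<close>
  define N where "N = insert 0 {\<theta>\<in>{0..tb}. \<not> continuous (at \<theta> within {0..tb}) s}"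
  have N: "countable N" "0 \<in> N"
    using mono_on_ctble_discont[OF mono] by (auto simp: N_def)
  have m_int: "(LINT \<omega>:{0..1}|lborel. m \<theta> \<omega>) = s \<theta>" if \<theta>: "\<theta> \<in> {0<..tb}" "\<theta> \<notin> N" for \<theta>
  proof -
    define g where "g k \<omega> = (fst (I (dyadic_below k \<theta>) \<omega>) + snd (I (dyadic_below k \<theta>) \<omega>)) / 2" for k \<omega>
    have g_meas: "g k \<in> borel_measurable borel" for k
      unfolding g_def by (rule measurable_compose[OF I_meas mid_meas])
    have g_bd: "\<bar>g k \<omega>\<bar> \<le> 1" for k \<omega>
    proof (cases "dyadic_below k \<theta> \<in> {0<..tb}")
      case True
      then have "bracket (F (dyadic_below k \<theta>)) (I (dyadic_below k \<theta>) \<omega>)"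
        using P[of \<omega>] by (simp add: pooling_def)
      then show ?thesis using F_bounds[of "dyadic_below k \<theta>"] True by (auto simp: bracket_def g_def)
    next
      case False
      then have "I (dyadic_below k \<theta>) \<omega> = (0, 0)" unfolding I_def by (rule if_not_P)
      then show ?thesis by (simp add: g_def)
    qed
    \<comment> \<open>Here the limit runs along a genuine sequence, so dominated convergence is
      available.\<close>
    have "(\<lambda>k. LINT \<omega>:{0..1}|lborel. g k \<omega>) \<longlonglongrightarrow> (LINT \<omega>:{0..1}|lborel. m \<theta> \<omega>)"
      unfolding set_lebesgue_integral_def
    proof (rule integral_dominated_convergence)
      show "integrable lborel (indicator {0..1::real} :: real \<Rightarrow> real)" by simp
      show "AE \<omega> in lborel. (\<lambda>k. indicator {0..1} \<omega> *\<^sub>R g k \<omega>) \<longlonglongrightarrow> indicator {0..1} \<omega> *\<^sub>R m \<theta> \<omega>"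
        unfolding g_def m_def using L_lim[OF \<theta>(1)] by (intro AE_I2 tendsto_intros) simp_all
      show "AE \<omega> in lborel. norm (indicator {0..1} \<omega> *\<^sub>R g k \<omega>) \<le> indicator {0..1} \<omega>" for k
        using g_bd by (auto simp: indicator_def)
      show "(\<lambda>\<omega>. indicator {0..1} \<omega> *\<^sub>R g k \<omega>) \<in> borel_measurable lborel" for k
        using g_meas[of k] by measurable
      have "(\<lambda>\<omega>. indicator {0..1} \<omega> *\<^sub>R m \<theta> \<omega>) \<in> borel_measurable borel" by measurable
      then show "(\<lambda>\<omega>. indicator {0..1} \<omega> *\<^sub>R m \<theta> \<omega>) \<in> borel_measurable lborel" by simp
    qed
    moreover have "(LINT \<omega>:{0..1}|lborel. g k \<omega>) = J (dyadic_below k \<theta>)" if d: "dyadic_below k \<theta> \<in> {0<..tb}" for k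
    proof -
      have "set_integrable lborel {0..1} (g k)"
        unfolding set_integrable_def
        by (rule Bochner_Integration.integrable_bound[of _ "indicator {0..1}"])
          (use g_meas[of k] g_bd in \<open>auto simp: indicator_def\<close>)
      then have "(LINT \<omega>:{0..1}|lborel. g k \<omega>) = integral {0..1} (g k)"
        by (rule set_borel_integral_eq_integral(2))
      also have "\<dots> = J (dyadic_below k \<theta>)"
      proof (rule integral_unique)
        have "((\<lambda>\<omega>. (fst (I0 (dyadic_below k \<theta>) \<omega>) + snd (I0 (dyadic_below k \<theta>) \<omega>)) / 2)
            has_integral 2 * J (dyadic_below k \<theta>) / 2) {0..1}"
          by (rule has_integral_divide[OF I0(4)[OF d]])
        then show "(g k has_integral J (dyadic_below k \<theta>)) {0..1}"
          by (subst has_integral_cong[where g = "\<lambda>\<omega>. (fst (I0 (dyadic_below k \<theta>) \<omega>) + snd (I0 (dyadic_below k \<theta>) \<omega>)) / 2"])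
            (use d clamp in \<open>auto simp: g_def I_def\<close>)
      qed
      finally show ?thesis .
    qed
    moreover have "eventually (\<lambda>k. dyadic_below k \<theta> \<in> {0<..tb}) sequentially"
      using eventually_dyadic_below[of 0 \<theta>] dyadic_below_less \<theta>
      by (auto elim!: eventually_mono intro: order_trans[OF less_imp_le])
    ultimately have "(\<lambda>k. J (dyadic_below k \<theta>)) \<longlonglongrightarrow> (LINT \<omega>:{0..1}|lborel. m \<theta> \<omega>)"
      by (elim Lim_transform_eventually) (auto elim!: eventually_mono)
    moreover have "(\<lambda>k. J (dyadic_below k \<theta>)) \<longlonglongrightarrow> s \<theta>"
    proof (rule tendsto_sandwich)
      have cont: "continuous (at \<theta> within {0..tb}) s" using \<theta> by (auto simp: N_def)
      \<comment> \<open>The lower bound for \<open>J\<close> requires a type strictly before the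
        approximant; subtracting \<open>1 / 2 ^ k\<close> provides one that still tends to \<theta>,
        where \<open>s\<close> is continuous.\<close>
      have shift: "(\<lambda>k. dyadic_below k \<theta> - 1 / 2 ^ k) \<longlonglongrightarrow> \<theta>"
        using tendsto_diff[OF dyadic_below_tendsto half_powers] by simp
      have pos: "eventually (\<lambda>k. 0 < dyadic_below k \<theta> - 1 / 2 ^ k) sequentially"
        using order_tendstoD(1)[OF shift, of 0] \<theta> by simp
      have small: "dyadic_below k \<theta> < tb" "dyadic_below k \<theta> - 1 / 2 ^ k < dyadic_below k \<theta>" for k
        using dyadic_below_less[of k \<theta>] \<theta> by auto
      show "(\<lambda>k. s (dyadic_below k \<theta> - 1 / 2 ^ k)) \<longlonglongrightarrow> s \<theta>"
      proof (intro continuous_within_tendsto_compose[OF cont _ shift])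
        show "eventually (\<lambda>k. dyadic_below k \<theta> - 1 / 2 ^ k \<in> {0..tb}) sequentially"
          using pos
        proof eventually_elim
          case (elim k)
          moreover have "dyadic_below k \<theta> - 1 / 2 ^ k \<le> tb" using small[of k] by linarith
          ultimately show ?case by simp
        qed
      qed
      show "(\<lambda>k. s (dyadic_below k \<theta>)) \<longlonglongrightarrow> s \<theta>"
      proof (intro continuous_within_tendsto_compose[OF cont _ dyadic_below_tendsto])
        show "eventually (\<lambda>k. dyadic_below k \<theta> \<in> {0..tb}) sequentially"
          using pos
        proof eventually_elim
          case (elim k)
          then have "0 \<le> dyadic_below k \<theta>" using small[of k] by linarith
          then show ?case using small[of k] by simp
        qed
      qed
      show "eventually (\<lambda>k. s (dyadic_below k \<theta> - 1 / 2 ^ k) \<le> J (dyadic_below k \<theta>)) sequentially"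
        using pos by eventually_elim (rule I0(6)[OF less_imp_le small(2) less_imp_le[OF small(1)]])
      show "eventually (\<lambda>k. J (dyadic_below k \<theta>) \<le> s (dyadic_below k \<theta>)) sequentially"
        using pos
      proof eventually_elim
        case (elim k)
        then have "0 < dyadic_below k \<theta>" using small[of k] by linarith
        then show ?case using small[of k] by (intro I0(5)) simp
      qed
    qed
    ultimately show ?thesis by (rule LIMSEQ_unique)
  qed
  define t where "t \<theta> = s (max 0 (min tb \<theta>))" for \<theta>
  have "mono t" unfolding t_def
    using tb_pos by (intro monoI mono_onD[OF mono]) auto
  then have [measurable]: "t \<in> borel_measurable borel" by (rule borel_measurable_mono)
  have t: "t \<theta> = s \<theta>" if "\<theta> \<in> {0..tb}" for \<theta> using that by (simp add: t_def)
  have "N \<in> null_sets lborel" by (rule countable_imp_null_set_lborel[OF N(1)])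
  then have [measurable]: "N \<in> sets borel" by auto
  \<comment> \<open>Mid-ranks are at most 1, so level 2 lies above all types outside
    \<open>N\<close>. As \<open>N\<close> is null, it carries status 1, and it is granted on a set
    of states of length \<open>s \<theta>\<close>.\<close>
  define X where "X \<theta> \<omega> = (if \<theta> \<in> N then if \<omega> \<le> t \<theta> then 2 else 0 else m \<theta> \<omega>)" for \<theta> \<omega>
  have X_meas [measurable]: "case_prod X \<in> borel_measurable (borel \<Otimes>\<^sub>M borel)"
    unfolding X_def split_beta' by measurable
  have sect [measurable]: "(\<lambda>\<theta>. X \<theta> \<omega>) \<in> borel_measurable borel" for \<omega> by measurable
  have level: "{\<theta>\<in>{0..tb}. X \<theta> \<omega> \<le> q} \<in> sets borel" for \<omega> q by measurable
  have X_m: "X \<theta> \<omega> = m \<theta> \<omega>" "\<theta> \<in> {0<..tb}" if "\<theta> \<in> {0..tb}" "\<theta> \<notin> N" for \<theta> \<omega>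
  proof -
    show "\<theta> \<in> {0<..tb}" using that N by (cases "\<theta> = 0") auto
  qed (use that in \<open>simp add: X_def\<close>)
  have status_m: "status tb f X \<omega> (X \<theta> \<omega>) = m \<theta> \<omega>" if "\<theta> \<in> {0..tb}" "\<theta> \<notin> N" for \<theta> \<omega>
  proof -
    have "X \<theta>' \<omega> = (fst (L \<theta>' \<omega>) + snd (L \<theta>' \<omega>)) / 2" if "\<theta>' \<in> {0<..tb} - N" for \<theta>'
      using X_m(1)[of \<theta>' \<omega>] that by (simp add: m_def)
    then have "status tb f X \<omega> (X \<theta> \<omega>) = X \<theta> \<omega>"
      using X_m(2)[OF that] that level by (intro status_pooling[OF L_pool[of \<omega>] N(1)]) auto
    then show ?thesis using X_m(1)[OF that] by simp
  qed
  have status_top: "status tb f X \<omega> (X \<theta> \<omega>) = indicator {..s \<theta>} \<omega>" if \<theta>: "\<theta> \<in> {0..tb}" "\<theta> \<in> N" for \<theta> \<omega>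
  proof -
    have one: "measure M A = 1" if "A \<in> sets borel" "{0..tb} - N \<subseteq> A" "A \<subseteq> {0..tb}" for A
      by (rule measure_sandwich[OF _ that(1,3) N(1)]) (use that F_bounds in auto)
    have X2: "X \<theta> \<omega> < 2" if "\<theta> \<in> {0..tb}" "\<theta> \<notin> N" for \<theta>
      using X_m(1)[OF that, of \<omega>] m_bounds[OF X_m(2)[OF that], of \<omega>] by simp
    have "measure M {\<theta>\<in>{0..tb}. X \<theta> \<omega> < 2} = 1"
    proof (rule one)
      show "{\<theta>\<in>{0..tb}. X \<theta> \<omega> < 2} \<in> sets borel" by measurable
    qed (use X2 in blast)+
    moreover have "measure M {\<theta>\<in>{0..tb}. X \<theta> \<omega> \<le> 2} = 1"
      by (rule one[OF level]) (use X2 less_imp_le in blast)+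
    ultimately have "status tb f X \<omega> 2 = 1"
      using status_eq[where X = X, OF level] by simp
    then show ?thesis using \<theta> t by (auto simp: X_def status_def)
  qed
  have "allocation tb X"
    unfolding allocation_def
  proof (intro conjI ballI)
    have "(\<lambda>p. X (fst p) (snd p)) \<in> borel_measurable borel"
      using X_meas by (simp add: split_beta' borel_prod)
    then show "(\<lambda>p. X (fst p) (snd p)) \<in> borel_measurable (restrict_space borel ({0..tb} \<times> {0..1}))"
      by (rule measurable_restrict_space1)
    show "0 \<le> X \<theta> \<omega>" if "\<theta> \<in> {0..tb}" for \<theta> \<omega>
      using X_m[OF that] m_bounds by (cases "\<theta> \<in> N") (auto simp: X_def)
  qed
  moreover have "set_integrable lborel {0..1} (\<lambda>\<omega>. status tb f X \<omega> (X \<theta> \<omega>)) \<and>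
      s \<theta> = interim_status tb f X \<theta>" if \<theta>: "\<theta> \<in> {0..tb}" for \<theta>
  proof (cases "\<theta> \<in> N")
    case True
    have "(\<lambda>\<omega>. indicator {0..1} \<omega> *\<^sub>R indicator {..s \<theta>} \<omega>) = (indicator {0..s \<theta>} :: real \<Rightarrow> real)"
      using range[OF \<theta>] by (auto simp: indicator_def)
    then show ?thesis
      using range[OF \<theta>] status_top[OF \<theta> True]
      by (simp add: set_integrable_def interim_status_def set_lebesgue_integral_def)
  next
    case False
    have "set_integrable lborel {0..1} (m \<theta>)"
      unfolding set_integrable_def
    proof (rule Bochner_Integration.integrable_bound[of _ "indicator {0..1} :: real \<Rightarrow> real"])
      have "(\<lambda>\<omega>. indicator {0..1} \<omega> *\<^sub>R m \<theta> \<omega>) \<in> borel_measurable borel" by measurable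
      then show "(\<lambda>\<omega>. indicator {0..1} \<omega> *\<^sub>R m \<theta> \<omega>) \<in> borel_measurable lborel" by simp
    qed (use m_bounds[OF X_m(2)[OF \<theta> False]] in \<open>auto simp: indicator_def\<close>)
    then show ?thesis
      using m_int[OF X_m(2)[OF \<theta> False] False] status_m[OF \<theta> False]
      by (simp add: interim_status_def)
  qed
  ultimately show ?thesis unfolding feasible_def by blast
qed

end

theorem theorem1:
  fixes tb :: real and f F s :: "real \<Rightarrow> real"
  assumes tb_pos: "0 < tb"
    and f_cont: "continuous_on {0..tb} f"
    and f_pos: "\<forall>\<theta>\<in>{0..tb}. f \<theta> > 0"
    and f_prob: "(LINT \<theta>:{0..tb}|lborel. f \<theta>) = 1"
    and F_def: "\<forall>x\<in>{0..tb}. F x = (LINT \<theta>:{0..x}|lborel. f \<theta>)"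
    and s_range: "\<forall>\<theta>\<in>{0..tb}. s \<theta> \<in> {0..1}"
    and s_mono: "mono_on {0..tb} s"
  shows "feasible tb f s \<longleftrightarrow>
    (\<forall>x\<in>{0..tb}. (LINT \<theta>:{x..tb}|lborel. s \<theta> * f \<theta>) \<le> (LINT \<theta>:{x..tb}|lborel. F \<theta> * f \<theta>))"
proof -
  interpret type_distribution tb f F by unfold_locales (fact assms)+
  show ?thesis
  proof
    assume "feasible tb f s"
    then show "\<forall>x\<in>{0..tb}. (LINT \<theta>:{x..tb}|lborel. s \<theta> * f \<theta>) \<le> (LINT \<theta>:{x..tb}|lborel. F \<theta> * f \<theta>)"
      using feasible_imp_majorized by blast
  next
    assume "\<forall>x\<in>{0..tb}. (LINT \<theta>:{x..tb}|lborel. s \<theta> * f \<theta>) \<le> (LINT \<theta>:{x..tb}|lborel. F \<theta> * f \<theta>)"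
    then show "feasible tb f s"
      using s_range s_mono by (intro majorized_imp_feasible) auto
  qed
qed

end
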